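(* Over the class of finite trees with navigational signature $\sigma=\{\downarrow,\downarrow_+,\rightarrow,\rightarrow^+\}$ (plus arbitrary unary predicates), the following logics are pairwise equally expressive for formulas with one free variable: $$\mathrm{CoreXPath}\equiv\mathrm{GF}^2[\sigma]\equiv\mathrm{FO}^2[\sigma]\equiv\mathrm{C}^2[\sigma]\equiv\mathrm{UNFO}[\sigma]\equiv\mathrm{F}_1[\sigma].$$
   Context: Let $\mathbb N^*$ be the set of finite sequences of naturals. A tree is a finite structure whose universe $T\subseteq\mathbb N^*$ satisfies: if $\langle\alpha,i\rangle\in T$ then $\alpha\in T$ and, if $i>0$, $\langle\alpha,i-1\rangle\in T$; it interprets finitely many unary predicates arbitrarily and the navigational relations as: $a\downarrow b$ (child) iff $b=\langle a,i\rangle$; $a\downarrow_+ b$ (descendant) iff $b=\langle a,\beta\rangle$ with $\beta$ nonempty; $a\rightarrow b$ (next sibling) iff $a=\langle\alpha,i\rangle,b=\langle\alpha,i+1\rangle$; $a\rightarrow^+b$ (following sibling) iff $a=\langle\alpha,i\rangle,b=\langle\alpha,j\rangle$, $i<j$. Logics: $\mathrm{F}_1$ is the smallest set of first-order formulas containing atoms and equalities, closed under $\vee,\neg$, and such that if $\varphi$ has free variables among $x_0,\dots,x_k$ then $\exists x_0\dots x_k\varphi$ and $\exists x_1\dots x_k\varphi$ are in it. $\mathrm{UNFO}$: smallest set containing atoms and equalities, closed under $\vee,\wedge,\exists$, and under $\neg\varphi$ when $\varphi$ has at most one free variable. $\mathrm{FO}^2$: first-order formulas with two variables; $\mathrm{C}^2$: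 $\mathrm{FO}^2$ plus counting quantifiers $\exists^{\ge C}y$, $\exists^{\le C}y$; $\mathrm{GF}^2$: two-variable guarded fragment (every quantification of the form $\exists\bar v(\alpha\wedge\psi)$ or $\forall\bar v(\alpha\to\psi)$ with $\alpha$ an atom containing all free variables of $\psi$). $\mathrm{CoreXPath}$: modal formulas built from propositional variables (the unary predicates) by Boolean connectives and the modalities $\langle\downarrow\rangle,\langle\uparrow\rangle,\langle\downarrow_+\rangle,\langle\uparrow^+\rangle,\langle\rightarrow\rangle,\langle\leftarrow\rangle,\langle\rightarrow^+\rangle,\langle\leftarrow^+\rangle$, where e.g. $\langle\downarrow\rangle\psi$ holds at $a$ iff $\psi$ holds at some child of $a$, and the others refer respectively to the parent, a descendant, an ancestor, the next sibling, the previous sibling, a following sibling, a preceding sibling; a CoreXPath formula is identified with its standard first-order translation (one free variable). Expressivity: $L_1\preceq L_2$ over a class if every $L_1$-formula with one free variable has an equivalent (on all structures of the class, at all elements) $L_2$-formula with one free variable over the same signature; $\equiv$ means both directions. *)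

theory Defs
  imports Main
begin

datatype nav = Child | Descendant | Next_Sibling | Following_Sibling

fun nav_rel :: "nav \<Rightarrow> nat list \<Rightarrow> nat list \<Rightarrow> bool" where
  "nav_rel Child a b \<longleftrightarrow> (\<exists>i. b = a @ [i])"
| "nav_rel Descendant a b \<longleftrightarrow> (\<exists>\<beta>. \<beta> \<noteq> [] \<and> b = a @ \<beta>)"
| "nav_rel Next_Sibling a b \<longleftrightarrow> (\<exists>\<alpha> i. a = \<alpha> @ [i] \<and> b = \<alpha> @ [i + 1])"
| "nav_rel Following_Sibling a b \<longleftrightarrow> (\<exists>\<alpha> i j. a = \<alpha> @ [i] \<and> b = \<alpha> @ [j] \<and> i < j)"

text \<open>The navigational relations of a tree are determined by its universe, so a structure
  consists only of a universe and an interpretation of the unary predicate symbols.\<close>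

record 'p tree =
  nodes :: "nat list set"
  label :: "'p \<Rightarrow> nat list set"

definition trees :: "'p set \<Rightarrow> 'p tree set" where
  "trees P = {T. finite (nodes T) \<and> nodes T \<noteq> {} \<and>
     (\<forall>\<alpha> i. \<alpha> @ [i] \<in> nodes T \<longrightarrow>
        \<alpha> \<in> nodes T \<and> (i > 0 \<longrightarrow> \<alpha> @ [i - 1] \<in> nodes T)) \<and>
     (\<forall>p\<in>P. label T p \<subseteq> nodes T)}"

text \<open>One syntax for all the logics: first-order formulas over variables \<open>0, 1, 2, \<dots>\<close>,
  extended by the counting quantifiers, which only \<open>C2\<close> below may use.\<close>

datatype (preds: 'p) fm =
    Unary 'p nat
  | Nav nav nat nat
  | Eql nat nat
  | Neg "'p fm"
  | Conj "'p fm" "'p fm"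
  | Disj "'p fm" "'p fm"
  | Impl "'p fm" "'p fm"
  | Exists nat "'p fm"
  | Forall nat "'p fm"
  | Exists_ge nat nat "'p fm"  \<comment> \<open>\<open>Exists_ge C y \<phi>\<close>: at least \<open>C\<close> elements \<open>y\<close> satisfy \<open>\<phi>\<close>\<close>
  | Exists_le nat nat "'p fm"

primrec sat :: "'p tree \<Rightarrow> (nat \<Rightarrow> nat list) \<Rightarrow> 'p fm \<Rightarrow> bool" where
  "sat T v (Unary p x) \<longleftrightarrow> v x \<in> label T p"
| "sat T v (Nav r x y) \<longleftrightarrow> nav_rel r (v x) (v y)"
| "sat T v (Eql x y) \<longleftrightarrow> v x = v y"
| "sat T v (Neg \<phi>) \<longleftrightarrow> \<not> sat T v \<phi>"
| "sat T v (Conj \<phi> \<psi>) \<longleftrightarrow> sat T v \<phi> \<and> sat T v \<psi>"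
| "sat T v (Disj \<phi> \<psi>) \<longleftrightarrow> sat T v \<phi> \<or> sat T v \<psi>"
| "sat T v (Impl \<phi> \<psi>) \<longleftrightarrow> (sat T v \<phi> \<longrightarrow> sat T v \<psi>)"
| "sat T v (Exists x \<phi>) \<longleftrightarrow> (\<exists>a\<in>nodes T. sat T (v(x := a)) \<phi>)"
| "sat T v (Forall x \<phi>) \<longleftrightarrow> (\<forall>a\<in>nodes T. sat T (v(x := a)) \<phi>)"
| "sat T v (Exists_ge C x \<phi>) \<longleftrightarrow> C \<le> card {a \<in> nodes T. sat T (v(x := a)) \<phi>}"
| "sat T v (Exists_le C x \<phi>) \<longleftrightarrow> card {a \<in> nodes T. sat T (v(x := a)) \<phi>} \<le> C"

primrec fv :: "'p fm \<Rightarrow> nat set" where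
  "fv (Unary p x) = {x}"
| "fv (Nav r x y) = {x, y}"
| "fv (Eql x y) = {x, y}"
| "fv (Neg \<phi>) = fv \<phi>"
| "fv (Conj \<phi> \<psi>) = fv \<phi> \<union> fv \<psi>"
| "fv (Disj \<phi> \<psi>) = fv \<phi> \<union> fv \<psi>"
| "fv (Impl \<phi> \<psi>) = fv \<phi> \<union> fv \<psi>"
| "fv (Exists x \<phi>) = fv \<phi> - {x}"
| "fv (Forall x \<phi>) = fv \<phi> - {x}"
| "fv (Exists_ge C x \<phi>) = fv \<phi> - {x}"
| "fv (Exists_le C x \<phi>) = fv \<phi> - {x}"

primrec vars :: "'p fm \<Rightarrow> nat set" where
  "vars (Unary p x) = {x}"
| "vars (Nav r x y) = {x, y}"
| "vars (Eql x y) = {x, y}"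
| "vars (Neg \<phi>) = vars \<phi>"
| "vars (Conj \<phi> \<psi>) = vars \<phi> \<union> vars \<psi>"
| "vars (Disj \<phi> \<psi>) = vars \<phi> \<union> vars \<psi>"
| "vars (Impl \<phi> \<psi>) = vars \<phi> \<union> vars \<psi>"
| "vars (Exists x \<phi>) = insert x (vars \<phi>)"
| "vars (Forall x \<phi>) = insert x (vars \<phi>)"
| "vars (Exists_ge C x \<phi>) = insert x (vars \<phi>)"
| "vars (Exists_le C x \<phi>) = insert x (vars \<phi>)"

primrec counting_free :: "'p fm \<Rightarrow> bool" where
  "counting_free (Unary p x) \<longleftrightarrow> True"
| "counting_free (Nav r x y) \<longleftrightarrow> True"
| "counting_free (Eql x y) \<longleftrightarrow> True"
| "counting_free (Neg \<phi>) \<longleftrightarrow> counting_free \<phi>"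
| "counting_free (Conj \<phi> \<psi>) \<longleftrightarrow> counting_free \<phi> \<and> counting_free \<psi>"
| "counting_free (Disj \<phi> \<psi>) \<longleftrightarrow> counting_free \<phi> \<and> counting_free \<psi>"
| "counting_free (Impl \<phi> \<psi>) \<longleftrightarrow> counting_free \<phi> \<and> counting_free \<psi>"
| "counting_free (Exists x \<phi>) \<longleftrightarrow> counting_free \<phi>"
| "counting_free (Forall x \<phi>) \<longleftrightarrow> counting_free \<phi>"
| "counting_free (Exists_ge C x \<phi>) \<longleftrightarrow> False"
| "counting_free (Exists_le C x \<phi>) \<longleftrightarrow> False"

text \<open>\<open>wff_F1\<close>, \<open>wff_UNFO\<close> and \<open>wff_GF\<close> leave the unary predicates unrestricted; the logics
  \<open>F1 P\<close>, \<open>UNFO P\<close>, \<open>GF2 P\<close> below consist of the formulas with predicates in \<open>P\<close>.\<close>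

inductive wff_F1 :: "'p fm \<Rightarrow> bool" where
  "wff_F1 (Unary p x)"
| "wff_F1 (Nav r x y)"
| "wff_F1 (Eql x y)"
| "wff_F1 \<phi> \<Longrightarrow> wff_F1 \<psi> \<Longrightarrow> wff_F1 (Disj \<phi> \<psi>)"
| "wff_F1 \<phi> \<Longrightarrow> wff_F1 (Neg \<phi>)"
| "wff_F1 \<phi> \<Longrightarrow> distinct (x # xs) \<Longrightarrow> fv \<phi> \<subseteq> set (x # xs) \<Longrightarrow>
    wff_F1 (foldr Exists (x # xs) \<phi>)"
| "wff_F1 \<phi> \<Longrightarrow> distinct (x # xs) \<Longrightarrow> fv \<phi> \<subseteq> set (x # xs) \<Longrightarrow>
    wff_F1 (foldr Exists xs \<phi>)"

inductive wff_UNFO :: "'p fm \<Rightarrow> bool" where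
  "wff_UNFO (Unary p x)"
| "wff_UNFO (Nav r x y)"
| "wff_UNFO (Eql x y)"
| "wff_UNFO \<phi> \<Longrightarrow> wff_UNFO \<psi> \<Longrightarrow> wff_UNFO (Disj \<phi> \<psi>)"
| "wff_UNFO \<phi> \<Longrightarrow> wff_UNFO \<psi> \<Longrightarrow> wff_UNFO (Conj \<phi> \<psi>)"
| "wff_UNFO \<phi> \<Longrightarrow> wff_UNFO (Exists x \<phi>)"
| "wff_UNFO \<phi> \<Longrightarrow> card (fv \<phi>) \<le> 1 \<Longrightarrow> wff_UNFO (Neg \<phi>)"

text \<open>Guards are relational atoms. Admitting equalities as guards as well would give a logic
  between this one and \<open>FO2\<close>.\<close>

inductive guard :: "'p fm \<Rightarrow> bool" where
  "guard (Unary p x)"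
| "guard (Nav r x y)"

inductive wff_GF :: "'p fm \<Rightarrow> bool" where
  "wff_GF (Unary p x)"
| "wff_GF (Nav r x y)"
| "wff_GF (Eql x y)"
| "wff_GF \<phi> \<Longrightarrow> wff_GF (Neg \<phi>)"
| "wff_GF \<phi> \<Longrightarrow> wff_GF \<psi> \<Longrightarrow> wff_GF (Conj \<phi> \<psi>)"
| "wff_GF \<phi> \<Longrightarrow> wff_GF \<psi> \<Longrightarrow> wff_GF (Disj \<phi> \<psi>)"
| "wff_GF \<phi> \<Longrightarrow> wff_GF \<psi> \<Longrightarrow> wff_GF (Impl \<phi> \<psi>)"
| "guard \<alpha> \<Longrightarrow> wff_GF \<psi> \<Longrightarrow> fv \<psi> \<subseteq> fv \<alpha> \<Longrightarrow> wff_GF (foldr Exists xs (Conj \<alpha> \<psi>))"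
| "guard \<alpha> \<Longrightarrow> wff_GF \<psi> \<Longrightarrow> fv \<psi> \<subseteq> fv \<alpha> \<Longrightarrow> wff_GF (foldr Forall xs (Impl \<alpha> \<psi>))"

definition F1 :: "'p set \<Rightarrow> 'p fm set" where
  "F1 P = {\<phi>. wff_F1 \<phi> \<and> preds \<phi> \<subseteq> P}"

definition UNFO :: "'p set \<Rightarrow> 'p fm set" where
  "UNFO P = {\<phi>. wff_UNFO \<phi> \<and> preds \<phi> \<subseteq> P}"

definition C2 :: "'p set \<Rightarrow> 'p fm set" where
  "C2 P = {\<phi>. (\<exists>x y. vars \<phi> \<subseteq> {x, y}) \<and> preds \<phi> \<subseteq> P}"

definition FO2 :: "'p set \<Rightarrow> 'p fm set" where
  "FO2 P = {\<phi>. counting_free \<phi> \<and> (\<exists>x y. vars \<phi> \<subseteq> {x, y}) \<and> preds \<phi> \<subseteq> P}"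

definition GF2 :: "'p set \<Rightarrow> 'p fm set" where
  "GF2 P = {\<phi>. wff_GF \<phi> \<and> (\<exists>x y. vars \<phi> \<subseteq> {x, y}) \<and> preds \<phi> \<subseteq> P}"

text \<open>The eight modalities: \<open>XDia r\<close> is the modality of the navigational relation \<open>r\<close>
  (child, descendant, next sibling, following sibling), \<open>XDia_inv r\<close> that of its converse
  (parent, ancestor, previous sibling, preceding sibling). The constant \<open>XTop\<close> makes the
  language nonempty when there are no propositional variables.\<close>

datatype (props: 'p) xpath =
    XProp 'p
  | XTop
  | XNeg "'p xpath"
  | XConj "'p xpath" "'p xpath"
  | XDisj "'p xpath" "'p xpath"
  | XDia nav "'p xpath"
  | XDia_inv nav "'p xpath"

text \<open>Standard translation with free variable \<open>x\<close>, alternating between \<open>x\<close> and \<open>y\<close>;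
  meaningful for \<open>x \<noteq> y\<close>.\<close>

primrec std_trans :: "'p xpath \<Rightarrow> nat \<Rightarrow> nat \<Rightarrow> 'p fm" where
  "std_trans (XProp p) x y = Unary p x"
| "std_trans XTop x y = Eql x x"
| "std_trans (XNeg \<phi>) x y = Neg (std_trans \<phi> x y)"
| "std_trans (XConj \<phi> \<psi>) x y = Conj (std_trans \<phi> x y) (std_trans \<psi> x y)"
| "std_trans (XDisj \<phi> \<psi>) x y = Disj (std_trans \<phi> x y) (std_trans \<psi> x y)"
| "std_trans (XDia r \<phi>) x y = Exists y (Conj (Nav r x y) (std_trans \<phi> y x))"
| "std_trans (XDia_inv r \<phi>) x y = Exists y (Conj (Nav r y x) (std_trans \<phi> y x))"

definition CoreXPath :: "'p set \<Rightarrow> 'p fm set" where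
  "CoreXPath P = {std_trans \<phi> x y |\<phi> x y. x \<noteq> y \<and> props \<phi> \<subseteq> P}"

text \<open>Since \<open>x\<close> is the only free variable, evaluating under the constant assignment \<open>\<lambda>_. a\<close>
  is evaluating at the element \<open>a\<close>.\<close>

definition expr_le :: "'p tree set \<Rightarrow> 'p fm set \<Rightarrow> 'p fm set \<Rightarrow> bool" where
  "expr_le K L1 L2 \<longleftrightarrow> (\<forall>\<phi>\<in>L1. \<forall>x. fv \<phi> = {x} \<longrightarrow>
     (\<exists>\<psi>\<in>L2. fv \<psi> = {x} \<and>
        (\<forall>T\<in>K. \<forall>a\<in>nodes T. sat T (\<lambda>_. a) \<phi> \<longleftrightarrow> sat T (\<lambda>_. a) \<psi>)))"

definition expr_equiv :: "'p tree set \<Rightarrow> 'p fm set \<Rightarrow> 'p fm set \<Rightarrow> bool" where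
  "expr_equiv K L1 L2 \<longleftrightarrow> expr_le K L1 L2 \<and> expr_le K L2 L1"

end

theory Submission
  imports Defs "HOL-Library.Sublist"
begin

text \<open>Call two pointed trees \<open>k\<close>-equivalent if they satisfy the same CoreXPath formulas from a finite
  list that grows with \<open>k\<close>. As the list is finite, every property of nodes that is invariant under some
  \<open>k\<close>-equivalence is CoreXPath definable. The key fact is that if \<open>a\<close> in \<open>T\<close> and \<open>a'\<close> in \<open>T'\<close> are
  sufficiently equivalent, then any set of at most \<open>n\<close> nodes containing \<open>a\<close> has a map into \<open>T'\<close> that
  sends \<open>a\<close> to \<open>a'\<close>, preserves and reflects equality and the navigational relations, and preserves
  \<open>k\<close>-equivalence: once closed under branching points, the set is connected by edges that modal
  formulas can follow, so it is mapped one leaf at a time. This handles a block of existential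
  quantifiers or a counting quantifier in one step, and thus each of the richer logics by induction
  on formulas.\<close>

section \<open>Geometry of the navigational relations\<close>

text \<open>Reflection is demanded along with preservation, so that negated atoms transfer and the
  inverse map has the same property.\<close>

definition nav_iso :: "nat list set \<Rightarrow> (nat list \<Rightarrow> nat list) \<Rightarrow> bool" where
  "nav_iso D f \<longleftrightarrow> (\<forall>x\<in>D. \<forall>y\<in>D. (f x = f y \<longleftrightarrow> x = y) \<and> (\<forall>r. nav_rel r (f x) (f y) \<longleftrightarrow> nav_rel r x y))"

text \<open>Swapping the two members yields the child towards the other one as well. The two
  children are siblings, and the sibling edges between them keep the images of the two subtrees
  apart.\<close>

definition branch_closed :: "nat list set \<Rightarrow> bool" where
  "branch_closed S \<longleftrightarrow> (\<forall>p i j u w. p @ i # u \<in> S \<longrightarrow> p @ j # w \<in> S \<longrightarrow> i \<noteq> j \<longrightarrow> p \<in> S \<and> p @ [i] \<in> S)"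

text \<open>The first image consists of the meets, the second of the nodes one step beyond a meet
  towards \<open>x\<close>; \<open>take\<close> stops at \<open>x\<close> if \<open>x\<close> is
  itself the meet. Pairs with \<open>x = y\<close> recover \<open>S\<close>.\<close>

definition branch_hull :: "nat list set \<Rightarrow> nat list set" where
  "branch_hull S = (\<lambda>(x, y). longest_common_prefix x y) ` (S \<times> S) \<union>
     (\<lambda>(x, y). take (Suc (length (longest_common_prefix x y))) x) ` (S \<times> S)"

section \<open>Closing a finite set under branching points\<close>

lemma nav_iff_strict_prefix: "nav_rel Descendant x y \<longleftrightarrow> strict_prefix x y"
  by (auto simp: strict_prefix_def prefix_def)

lemma lcp_branch: "i \<noteq> j \<Longrightarrow> longest_common_prefix (p @ i # u) (p @ j # w) = p"
  by (induction p) auto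

lemma lcp_self: "longest_common_prefix x x = x"
  by (induction x) auto

lemma subset_branch_hull: "S \<subseteq> branch_hull S"
  unfolding branch_hull_def by (force simp: lcp_self image_iff)

lemma branch_hull_prefix:
  assumes "x \<in> branch_hull S"
  obtains y where "y \<in> S" "prefix x y"
  using assms unfolding branch_hull_def
  by (auto intro: longest_common_prefix_prefix1 take_is_prefix)

lemma finite_branch_hull: "finite S \<Longrightarrow> finite (branch_hull S)"
  unfolding branch_hull_def by auto

lemma card_branch_hull:
  assumes "finite S"
  shows "card (branch_hull S) \<le> 2 * (card S * card S)"
proof -
  have "card (g ` (S \<times> S)) \<le> card S * card S" for g :: "nat list \<times> nat list \<Rightarrow> nat list"
    using card_image_le[of "S \<times> S" g] assms by (simp add: card_cartesian_product)
  then show ?thesis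
    unfolding branch_hull_def mult_2 by (intro order_trans[OF card_Un_le] add_mono)
qed

text \<open>One round of closure suffices: members of the hull are prefixes of members of
  \<open>S\<close>, so two of them that part at \<open>p\<close> extend to members of
  \<open>S\<close> that part at \<open>p\<close> in the same directions.\<close>

lemma branch_closed_branch_hull: "branch_closed (branch_hull S)"
  unfolding branch_closed_def
proof (intro allI impI)
  fix p i j u w
  assume 1: "p @ i # u \<in> branch_hull S" and 2: "p @ j # w \<in> branch_hull S" and ij: "i \<noteq> j"
  obtain u' where u': "p @ i # u' \<in> S"
    using branch_hull_prefix[OF 1] by (auto simp: prefix_def)
  obtain w' where w': "p @ j # w' \<in> S"
    using branch_hull_prefix[OF 2] by (auto simp: prefix_def)
  note l = lcp_branch[OF ij, of p u' w']
  have "p \<in> branch_hull S"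
    unfolding branch_hull_def using u' w' l by force
  moreover have "p @ [i] \<in> branch_hull S"
  proof -
    have "p @ [i] = (\<lambda>(x, y). take (Suc (length (longest_common_prefix x y))) x) (p @ i # u', p @ j # w')"
      using l by simp
    then show ?thesis unfolding branch_hull_def using u' w' by blast
  qed
  ultimately show "p \<in> branch_hull S \<and> p @ [i] \<in> branch_hull S" ..
qed

section \<open>How a third node relates to the two ends of an edge\<close>

lemma nav_rel_irrefl: "\<not> nav_rel r x x"
  by (cases r) auto

lemma nav_rel_asym: "nav_rel r x y \<Longrightarrow> \<not> nav_rel s y x"
  by (cases r; cases s) auto

lemma nav_rel_cases:
  assumes "nav_rel r x y"
  shows "nav_rel Descendant x y \<or> nav_rel Following_Sibling x y"
  using assms by (cases r) fastforce+

text \<open>At least two child steps separate \<open>x\<close> from \<open>d\<close>, which excludes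
  \<open>Child\<close>. This lemma and the next four read off how \<open>x\<close> relates to
  \<open>d\<close> from how it relates to \<open>c\<close> (or to the parent of \<open>c\<close>).
  Applied in both trees, they show that a new image of \<open>d\<close> fits all nodes as soon as it
  fits \<open>c\<close>.\<close>

lemma nav_rel_ancestor_of_ancestor:
  assumes "nav_rel Descendant x c" "nav_rel Descendant c d"
  shows "nav_rel r x d \<longleftrightarrow> r = Descendant" "\<not> nav_rel r d x" "x \<noteq> d"
proof -
  obtain \<beta> \<gamma> where *: "c = x @ \<beta>" "d = (x @ \<beta>) @ \<gamma>" "\<beta> \<noteq> []" "\<gamma> \<noteq> []" using assms by auto
  have D: "nav_rel Descendant x d" using * by auto
  then show "\<not> nav_rel r d x" "x \<noteq> d" using nav_rel_asym nav_rel_irrefl by blast+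
  have "length d > Suc (length x)" using * by (cases \<beta>; cases \<gamma>) auto
  then show "nav_rel r x d \<longleftrightarrow> r = Descendant" using D by (cases r) auto
qed

text \<open>The subtree of \<open>c\<close> contains \<open>d\<close> and also every sibling of
  \<open>d\<close>, whereas \<open>x\<close> is neither in this subtree nor above it.\<close>

lemma nav_rel_below_incomparable:
  assumes "nav_rel Descendant c d" "\<not> nav_rel Descendant x c" "\<not> nav_rel Descendant c x" "x \<noteq> c"
  shows "\<not> nav_rel r x d" "\<not> nav_rel r d x" "x \<noteq> d"
proof -
  have cd: "strict_prefix c d" "\<not> prefix x c" "\<not> prefix c x" 
    using assms unfolding nav_iff_strict_prefix by (auto simp: strict_prefix_def)
  then have p: "\<not> prefix x d" "\<not> prefix d x"
    by (meson prefix_same_cases strict_prefix_def prefix_order.trans)+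
  then show "x \<noteq> d" by auto
  have sib: False if "x = q @ [i]" "d = q @ [j]" for q i j
  proof -
    have "prefix c q" using cd(1) that(2) by (metis prefix_snoc strict_prefix_def)
    then show False using that(1) cd(3) by auto
  qed
  have F: "\<not> nav_rel Following_Sibling x d" "\<not> nav_rel Following_Sibling d x"
    by (auto dest: sib)
  have D: "\<not> nav_rel Descendant x d" "\<not> nav_rel Descendant d x"
    using p unfolding nav_iff_strict_prefix by (auto simp: strict_prefix_def)
  show "\<not> nav_rel r x d" "\<not> nav_rel r d x"
    using F D nav_rel_cases by metis+
qed

text \<open>Since \<open>c\<close> lies strictly between the two, \<open>Next_Sibling\<close> is
  excluded.\<close>

lemma nav_rel_sibling_of_sibling:
  assumes "nav_rel Following_Sibling x c" "nav_rel Following_Sibling c d"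
  shows "nav_rel r x d \<longleftrightarrow> r = Following_Sibling" "\<not> nav_rel r d x" "x \<noteq> d"
proof -
  have D: "nav_rel Following_Sibling x d" using assms by auto
  then show "\<not> nav_rel r d x" "x \<noteq> d" using nav_rel_asym nav_rel_irrefl by blast+
  show "nav_rel r x d \<longleftrightarrow> r = Following_Sibling" using D assms by (cases r) auto
qed

text \<open>Siblings have the same ancestors at the same distances.\<close>

lemma nav_rel_ancestor_of_sibling:
  assumes "nav_rel Descendant x c" "nav_rel Following_Sibling c d"
  shows "nav_rel r x d \<longleftrightarrow> nav_rel r x c" "\<not> nav_rel r d x" "x \<noteq> d"
proof -
  obtain p i j where *: "c = p @ [i]" "d = p @ [j]" "i < j" using assms by auto
  have "prefix x p" using assms(1) * unfolding nav_iff_strict_prefix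
    by (metis prefix_snoc strict_prefix_def)
  then obtain q where q: "p = x @ q" by (auto simp: prefix_def)
  then have D: "nav_rel Descendant x d" using * by auto
  then show "\<not> nav_rel r d x" "x \<noteq> d" using nav_rel_asym nav_rel_irrefl by blast+
  show "nav_rel r x d \<longleftrightarrow> nav_rel r x c" using D assms * q by (cases r) auto
qed

text \<open>A node related to \<open>d\<close> is an ancestor of \<open>d\<close>, hence of its
  sibling \<open>c\<close>, or it is a sibling or descendant of \<open>d\<close>, hence below
  \<open>p\<close>.\<close>

lemma nav_rel_sibling_elsewhere:
  assumes "nav_rel Following_Sibling c d" "nav_rel Child p c" "\<not> nav_rel Descendant p x"
    "\<not> nav_rel Descendant x c"
  shows "\<not> nav_rel r x d" "\<not> nav_rel r d x" "x \<noteq> d"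
proof -
  obtain i j where *: "c = p @ [i]" "d = p @ [j]" "i < j" using assms by auto
  show "x \<noteq> d" using * assms(3) by auto
  show "\<not> nav_rel r d x" using * assms(3) by (cases r) auto
  show "\<not> nav_rel r x d"
  proof
    assume "nav_rel r x d"
    then consider "nav_rel Descendant x d" | "nav_rel Following_Sibling x d"
      using nav_rel_cases by blast
    then show False
    proof cases
      case 1
      then have "prefix x p" using * unfolding nav_iff_strict_prefix
        by (metis prefix_snoc strict_prefix_def)
      then show False using assms(4) * by (auto simp: prefix_def)
    next
      case 2
      then show False using * assms(3) by auto
    qed
  qed
qed

section \<open>Removing and reattaching a leaf\<close>

lemma nav_iso_fun_upd:
  assumes "nav_iso (S - {d}) f"
    and "\<And>x. x \<in> S - {d} \<Longrightarrow> f x \<noteq> d' \<and> (\<forall>r. (nav_rel r (f x) d' \<longleftrightarrow> nav_rel r x d) \<and> (nav_rel r d' (f x) \<longleftrightarrow> nav_rel r d x))"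
  shows "nav_iso S (f(d := d'))"
  unfolding nav_iso_def
proof (intro ballI)
  fix x y assume "x \<in> S" "y \<in> S"
  then show "((f(d := d')) x = (f(d := d')) y \<longleftrightarrow> x = y) \<and>
     (\<forall>r. nav_rel r ((f(d := d')) x) ((f(d := d')) y) \<longleftrightarrow> nav_rel r x y)"
    using assms(1) assms(2)[of x] assms(2)[of y] unfolding nav_iso_def
    by (cases "x = d"; cases "y = d") (auto simp: nav_rel_irrefl simp del: nav_rel.simps)
qed

text \<open>Branch closure only demands prefixes of members, and \<open>d\<close> is a prefix of no
  other member of \<open>S\<close>.\<close>

lemma branch_closed_leaf:
  assumes "branch_closed S" "\<And>x. x \<in> S \<Longrightarrow> \<not> strict_prefix d x"
  shows "branch_closed (S - {d})"
  unfolding branch_closed_def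
proof (intro allI impI)
  fix p i j u w
  assume 1: "p @ i # u \<in> S - {d}" and 2: "p @ j # w \<in> S - {d}" and ij: "i \<noteq> j"
  have "p \<in> S" "p @ [i] \<in> S"
    using assms(1) 1 2 ij unfolding branch_closed_def by blast+
  moreover have "p \<noteq> d" "p @ [i] \<noteq> d"
    using assms(2)[of "p @ i # u"] 1 by (auto simp: strict_prefix_def prefix_def)
  ultimately show "p \<in> S - {d} \<and> p @ [i] \<in> S - {d}" by blast
qed

lemma exists_maximal:
  fixes m :: "'a \<Rightarrow> nat"
  assumes "finite A" "A \<noteq> {}"
  shows "\<exists>x\<in>A. \<forall>y\<in>A. m y \<le> m x"
proof -
  have "Max (m ` A) \<in> m ` A" using assms by simp
  then obtain x where "x \<in> A" "m x = Max (m ` A)" by auto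
  then show ?thesis using assms by (intro bexI[of _ x]) auto
qed

text \<open>The leaf is a deepest node of \<open>S\<close>. Depending on whether it has a sibling in \<open>S\<close>, it hangs off
  the nearest sibling to its left or off its nearest ancestor.\<close>

lemma branch_closed_remove_leaf:
  assumes "finite S" "branch_closed S" "a \<in> S" "b \<in> S" "a \<noteq> b"
  shows "\<exists>d\<in>S. \<exists>c\<in>S - {d}. branch_closed (S - {d}) \<and> (\<exists>r. nav_rel r c d) \<and>
    (\<forall>f d'. nav_iso (S - {d}) f \<longrightarrow> (\<forall>r. nav_rel r (f c) d' \<longleftrightarrow> nav_rel r c d) \<longrightarrow> nav_iso S (f(d := d')))"
proof -
  obtain d0 where d0: "d0 \<in> S" "\<And>y. y \<in> S \<Longrightarrow> length y \<le> length d0"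
    using exists_maximal[of S length] assms by blast
  have "d0 \<noteq> []" using d0 assms by (metis le_zero_eq length_0_conv list.size(3))
  then obtain p j0 where d0p: "d0 = p @ [j0]" by (metis rev_exhaust)
  \<comment> \<open>Among the members of \<open>S\<close> with the parent of \<open>d0\<close>, the
    rightmost is removed, so that its siblings in \<open>S\<close> can only lie to its left.\<close>
  have "finite {x \<in> S. \<exists>j. x = p @ [j]}" "{x \<in> S. \<exists>j. x = p @ [j]} \<noteq> {}"
    using assms d0 d0p by auto
  then obtain d where d: "d \<in> {x \<in> S. \<exists>j. x = p @ [j]}"
    "\<forall>y\<in>{x \<in> S. \<exists>j. x = p @ [j]}. last y \<le> last d"
    by (rule bexE[OF exists_maximal[where m = last]])
  then obtain j where dS: "d \<in> S" and dp: "d = p @ [j]" by auto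
  have jmax: "i \<le> j" if "p @ [i] \<in> S" for i using d(2) that dp by auto
  have deep: "length y \<le> length d" if "y \<in> S" for y using d0 d0p dp that by auto
  have leaf: "\<not> strict_prefix d x" if "x \<in> S" for x
    using deep[OF that] prefix_length_less by fastforce
  note cl = branch_closed_leaf[OF assms(2) leaf]
  show ?thesis
  proof (cases "\<exists>i. i < j \<and> p @ [i] \<in> S")
    case True
    have "finite {x \<in> S. \<exists>i<j. x = p @ [i]}" "{x \<in> S. \<exists>i<j. x = p @ [i]} \<noteq> {}"
      using assms True by auto
    then obtain c where c: "c \<in> {x \<in> S. \<exists>i<j. x = p @ [i]}"
      "\<forall>y\<in>{x \<in> S. \<exists>i<j. x = p @ [i]}. last y \<le> last c"
      by (rule bexE[OF exists_maximal[where m = last]])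
    then obtain i where cS: "c \<in> S" and cp: "c = p @ [i]" and ij: "i < j" by auto
    have imax: "l \<le> i" if "p @ [l] \<in> S" "l < j" for l using c(2) that cp by auto
    \<comment> \<open>The siblings \<open>c\<close> and \<open>d\<close> part at \<open>p\<close>,
      so branch closure puts their parent into \<open>S\<close>. The map therefore preserves
      \<open>p\<close> as well, which locates the nodes outside the subtree of \<open>p\<close> in
      the image.\<close>
    have pS: "p \<in> S" using assms(2) dS dp cS cp ij unfolding branch_closed_def by blast
    have cd: "nav_rel Following_Sibling c d" using cp dp ij by auto
    have pc: "nav_rel Child p c" using cp by auto
    have cSd: "c \<in> S - {d}" using cS cd nav_rel_irrefl by blast
    show ?thesis
    proof (intro bexI[OF _ dS] bexI[OF _ cSd] conjI cl allI impI)
      show "\<exists>r. nav_rel r c d" using cd by blast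
      fix f d' assume f: "nav_iso (S - {d}) f" and r: "\<forall>r. nav_rel r (f c) d' \<longleftrightarrow> nav_rel r c d"
      have cd': "nav_rel Following_Sibling (f c) d'" using r cd by blast
      have pSd: "p \<in> S - {d}" using pS dp by auto
      then have pc': "nav_rel Child (f p) (f c)" using f cSd pc unfolding nav_iso_def by blast
      show "nav_iso S (f(d := d'))"
      proof (rule nav_iso_fun_upd[OF f])
        fix x assume x: "x \<in> S - {d}"
        \<comment> \<open>A member below \<open>p\<close> is no deeper than \<open>d\<close>, hence
          a child of \<open>p\<close>. Its index is less than \<open>j\<close>, hence at most
          \<open>i\<close> by the choice of \<open>c\<close>.\<close>
        consider "x = c" | "nav_rel Following_Sibling x c" | "nav_rel Descendant x c"
          | "\<not> nav_rel Descendant p x" "\<not> nav_rel Descendant x c"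
        proof (cases "nav_rel Descendant p x")
          case True
          then obtain \<beta> where \<beta>: "x = p @ \<beta>" "\<beta> \<noteq> []" by auto
          moreover have "length x \<le> length d" using x deep by auto
          ultimately obtain l where l: "x = p @ [l]" using dp by (cases \<beta>) auto
          then have "l < j" using x jmax[of l] dp by (cases "l = j") auto
          then have "l \<le> i" using imax x l by auto
          then show ?thesis using that(1,2) l cp by (cases "l = i") auto
        qed (use that in blast)
        then show "f x \<noteq> d' \<and> (\<forall>r. (nav_rel r (f x) d' \<longleftrightarrow> nav_rel r x d) \<and> (nav_rel r d' (f x) \<longleftrightarrow> nav_rel r d x))"
        proof cases
          case 1
          then show ?thesis using r cd cd' nav_rel_asym nav_rel_irrefl by metis
        next
          case 2
          moreover have "nav_rel Following_Sibling (f x) (f c)"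
            using 2 x cSd f unfolding nav_iso_def by blast
          ultimately show ?thesis
            using nav_rel_sibling_of_sibling cd cd' by metis
        next
          case 3
          moreover have "\<And>r. nav_rel r (f x) (f c) = nav_rel r x c"
            using 3 x cSd f unfolding nav_iso_def by blast
          ultimately show ?thesis
            using nav_rel_ancestor_of_sibling cd cd' by metis
        next
          case 4
          moreover have "\<not> nav_rel Descendant (f p) (f x)" "\<not> nav_rel Descendant (f x) (f c)"
            using 4 x cSd pSd f unfolding nav_iso_def by blast+
          ultimately show ?thesis
            using nav_rel_sibling_elsewhere cd cd' pc pc' by metis
        qed
      qed
    qed
  next
    case False
    have nosib: "l = j" if "p @ [l] \<in> S" for l
      using False jmax that by (metis le_neq_implies_less)
    \<comment> \<open>If \<open>x\<close> and \<open>d\<close> part at \<open>q\<close>, then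
      \<open>e\<close> is the child of \<open>q\<close> towards \<open>d\<close>, a member of
      \<open>S\<close> by branch closure. It differs from \<open>d\<close>, as otherwise the child
      of \<open>q\<close> towards \<open>x\<close> would be a sibling of \<open>d\<close> in
      \<open>S\<close>.\<close>
    have branch: "\<exists>e\<in>S. strict_prefix e d \<and> (\<forall>q. prefix q x \<and> prefix q d \<longrightarrow> strict_prefix q e)"
      if x: "x \<in> S" "x \<noteq> d" "\<not> strict_prefix x d" for x
    proof -
      have "\<not> prefix x d" "\<not> prefix d x"
        using x leaf[OF x(1)] by (auto simp: strict_prefix_def)
      then have "d \<parallel> x" by auto
      then obtain q l u m w where q: "l \<noteq> m" "d = q @ l # u" "x = q @ m # w"
        using parallel_decomp by blast
      have e: "q @ [l] \<in> S" and e': "q @ [m] \<in> S"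
        using assms(2) q x dS unfolding branch_closed_def by metis+
      have "q @ [l] \<noteq> d"
      proof
        assume "q @ [l] = d"
        then show False using e' nosib[of m] dp q by auto
      qed
      then have "strict_prefix (q @ [l]) d" using q by (auto simp: strict_prefix_def)
      moreover have "strict_prefix s (q @ [l])" if s: "prefix s x" "prefix s d" for s
      proof -
        have "prefix s q" using s q
          by (metis lcp_branch longest_common_prefix_max_prefix)
        then show ?thesis by (auto simp: strict_prefix_def prefix_def)
      qed
      ultimately show ?thesis using e by blast
    qed
    \<comment> \<open>Either \<open>x0\<close> lies above \<open>d\<close>, or \<open>branch\<close>
      supplies a member that does; so \<open>d\<close> has a nearest ancestor \<open>c\<close> in
      \<open>S\<close>.\<close>
    obtain x0 where "x0 \<in> S" "x0 \<noteq> d" using assms by metis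
    then have ne: "{x \<in> S. strict_prefix x d} \<noteq> {}" using branch[of x0] by blast
    have "finite {x \<in> S. strict_prefix x d}" using assms by auto
    from this ne obtain c where c: "c \<in> {x \<in> S. strict_prefix x d}"
      "\<forall>y\<in>{x \<in> S. strict_prefix x d}. length y \<le> length c"
      by (rule bexE[OF exists_maximal[where m = length]])
    have above: "prefix y c" if "y \<in> S" "strict_prefix y d" for y
      using c that by (metis (mono_tags, lifting) mem_Collect_eq prefix_length_prefix strict_prefix_def)
    have cd: "nav_rel Descendant c d" using c nav_iff_strict_prefix by blast
    have cSd: "c \<in> S - {d}" using c cd nav_rel_irrefl by blast
    show ?thesis
    proof (intro bexI[OF _ dS] bexI[OF _ cSd] conjI cl allI impI)
      show "\<exists>r. nav_rel r c d" using cd by blast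
      fix f d' assume f: "nav_iso (S - {d}) f" and r: "\<forall>r. nav_rel r (f c) d' \<longleftrightarrow> nav_rel r c d"
      have cd': "nav_rel Descendant (f c) d'" using r cd by blast
      show "nav_iso S (f(d := d'))"
      proof (rule nav_iso_fun_upd[OF f])
        fix x assume x: "x \<in> S - {d}"
        consider "x = c" | "nav_rel Descendant x c"
          | "\<not> nav_rel Descendant x c" "\<not> nav_rel Descendant c x" "x \<noteq> c"
        proof (cases "strict_prefix x d")
          case True
          then have "prefix x c" using above x by auto
          then show ?thesis using that(1,2) nav_iff_strict_prefix by (auto simp: strict_prefix_def)
        next
          case False
          then obtain e where e: "e \<in> S" "strict_prefix e d" "\<And>q. prefix q x \<Longrightarrow> prefix q d \<Longrightarrow> strict_prefix q e"
            using branch[of x] x by auto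
          \<comment> \<open>If \<open>c\<close> were a prefix of \<open>x\<close>, it would be a
            common prefix of \<open>x\<close> and \<open>d\<close>, hence strictly above
            \<open>e\<close>; but \<open>e\<close> is at or above \<open>c\<close>.\<close>
          have "prefix e c" using e above by auto
          then have "\<not> prefix c x" using e(3)[of c] c
            by (metis (no_types, lifting) mem_Collect_eq prefix_order.less_le_not_le)
          moreover have "\<not> prefix x c" using False c x
            by (metis (no_types, lifting) mem_Collect_eq prefix_order.le_less_trans)
          ultimately show ?thesis using that(3) unfolding nav_iff_strict_prefix by (auto simp: strict_prefix_def)
        qed
        then show "f x \<noteq> d' \<and> (\<forall>r. (nav_rel r (f x) d' \<longleftrightarrow> nav_rel r x d) \<and> (nav_rel r d' (f x) \<longleftrightarrow> nav_rel r d x))"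
        proof cases
          case 1
          then show ?thesis using r cd cd' nav_rel_asym nav_rel_irrefl by metis
        next
          case 2
          moreover have "nav_rel Descendant (f x) (f c)"
            using 2 x cSd f unfolding nav_iso_def by blast
          ultimately show ?thesis
            using nav_rel_ancestor_of_ancestor cd cd' by metis
        next
          case 3
          moreover have "\<not> nav_rel Descendant (f x) (f c)" "\<not> nav_rel Descendant (f c) (f x)" "f x \<noteq> f c"
            using 3 x cSd f unfolding nav_iso_def by blast+
          ultimately show ?thesis
            using nav_rel_below_incomparable cd cd' by metis
        qed
      qed
    qed
  qed
qed

section \<open>Finitely many modal types of bounded depth\<close>

primrec xsat :: "'p tree \<Rightarrow> nat list \<Rightarrow> 'p xpath \<Rightarrow> bool" where
  "xsat T a (XProp p) \<longleftrightarrow> a \<in> label T p"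
| "xsat T a XTop \<longleftrightarrow> True"
| "xsat T a (XNeg \<phi>) \<longleftrightarrow> \<not> xsat T a \<phi>"
| "xsat T a (XConj \<phi> \<psi>) \<longleftrightarrow> xsat T a \<phi> \<and> xsat T a \<psi>"
| "xsat T a (XDisj \<phi> \<psi>) \<longleftrightarrow> xsat T a \<phi> \<or> xsat T a \<psi>"
| "xsat T a (XDia r \<phi>) \<longleftrightarrow> (\<exists>b\<in>nodes T. nav_rel r a b \<and> xsat T b \<phi>)"
| "xsat T a (XDia_inv r \<phi>) \<longleftrightarrow> (\<exists>b\<in>nodes T. nav_rel r b a \<and> xsat T b \<phi>)"

text \<open>A cell fixes a truth value for every formula of the list, so the cells sort the pointed
  trees by their truth patterns on the list.\<close>

primrec cells :: "'p xpath list \<Rightarrow> 'p xpath list" where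
  "cells [] = [XTop]"
| "cells (\<phi> # L) = map (XConj \<phi>) (cells L) @ map (XConj (XNeg \<phi>)) (cells L)"

lemma cells_cover: "\<exists>\<chi>\<in>set (cells L). xsat T a \<chi>"
  by (induction L) (auto simp: bex_Un)

lemma cells_agree:
  assumes "\<chi> \<in> set (cells L)" "xsat T a \<chi>"
  shows "xsat T' b \<chi> \<longleftrightarrow> (\<forall>\<phi>\<in>set L. xsat T a \<phi> \<longleftrightarrow> xsat T' b \<phi>)"
  using assms by (induction L arbitrary: \<chi>) auto

lemma props_cells: "\<chi> \<in> set (cells L) \<Longrightarrow> props \<chi> \<subseteq> (\<Union>\<phi>\<in>set L. props \<phi>)"
  by (induction L arbitrary: \<chi>) fastforce+

text \<open>The new diamonds are applied to cells, not to single features. Agreement at level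
  \<open>Suc k\<close> thus fixes which complete level \<open>k\<close> patterns occur at the
  neighbours along each relation.\<close>

primrec feats :: "'p list \<Rightarrow> nat \<Rightarrow> 'p xpath list" where
  "feats ps 0 = map XProp ps"
| "feats ps (Suc k) = feats ps k @ concat (map (\<lambda>\<chi>. concat (map (\<lambda>r. [XDia r \<chi>, XDia_inv r \<chi>])
     [Child, Descendant, Next_Sibling, Following_Sibling])) (cells (feats ps k)))"

lemma set_feats_Suc: "set (feats ps (Suc k)) = set (feats ps k) \<union>
   (\<Union>\<chi>\<in>set (cells (feats ps k)). \<Union>r. {XDia r \<chi>, XDia_inv r \<chi>})"
proof -
  have U: "(UNIV :: nav set) = {Child, Descendant, Next_Sibling, Following_Sibling}"
    using nav.exhaust by auto
  show ?thesis by (simp add: U) blast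
qed

lemma props_feats: "\<phi> \<in> set (feats ps k) \<Longrightarrow> props \<phi> \<subseteq> set ps"
proof (induction k arbitrary: \<phi>)
  case (Suc k)
  then show ?case
    unfolding set_feats_Suc using props_cells[of _ "feats ps k"] by fastforce
qed auto

definition type_eq :: "'p list \<Rightarrow> nat \<Rightarrow> 'p tree \<Rightarrow> nat list \<Rightarrow> 'p tree \<Rightarrow> nat list \<Rightarrow> bool" where
  "type_eq ps k T a T' b \<longleftrightarrow> (\<forall>\<phi>\<in>set (feats ps k). xsat T a \<phi> \<longleftrightarrow> xsat T' b \<phi>)"

lemma type_eq_sym: "type_eq ps k T a T' b \<Longrightarrow> type_eq ps k T' b T a"
  unfolding type_eq_def by simp

lemma type_eq_mono: "type_eq ps l T a T' b \<Longrightarrow> k \<le> l \<Longrightarrow> type_eq ps k T a T' b"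
proof (induction l)
  case (Suc l)
  then show ?case
    by (cases "k = Suc l") (auto simp: type_eq_def set_feats_Suc simp del: feats.simps)
qed auto

lemma type_eq_label: "type_eq ps k T a T' b \<Longrightarrow> p \<in> set ps \<Longrightarrow> a \<in> label T p \<longleftrightarrow> b \<in> label T' p"
  using type_eq_mono[of ps k T a T' b 0] by (auto simp: type_eq_def)

text \<open>Some cell holds at \<open>b\<close>, and the diamond over it is a feature of the next
  level, so it transfers to \<open>a'\<close>. Any node where this cell holds agrees with
  \<open>b\<close> on all features of level \<open>k\<close>.\<close>

lemma type_eq_forth:
  assumes "type_eq ps (Suc k) T a T' a'" "b \<in> nodes T" "nav_rel r a b"
  shows "\<exists>b'\<in>nodes T'. nav_rel r a' b' \<and> type_eq ps k T b T' b'"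
proof -
  obtain \<chi> where \<chi>: "\<chi> \<in> set (cells (feats ps k))" "xsat T b \<chi>" using cells_cover by blast
  then have "XDia r \<chi> \<in> set (feats ps (Suc k))" unfolding set_feats_Suc by blast
  moreover have "xsat T a (XDia r \<chi>)" using \<chi> assms by auto
  ultimately have "xsat T' a' (XDia r \<chi>)" using assms unfolding type_eq_def by blast
  then show ?thesis using cells_agree[OF \<chi>] unfolding type_eq_def by auto
qed

lemma type_eq_forth_inv:
  assumes "type_eq ps (Suc k) T a T' a'" "b \<in> nodes T" "nav_rel r b a"
  shows "\<exists>b'\<in>nodes T'. nav_rel r b' a' \<and> type_eq ps k T b T' b'"
proof -
  obtain \<chi> where \<chi>: "\<chi> \<in> set (cells (feats ps k))" "xsat T b \<chi>" using cells_cover by blast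
  then have "XDia_inv r \<chi> \<in> set (feats ps (Suc k))" unfolding set_feats_Suc by blast
  moreover have "xsat T a (XDia_inv r \<chi>)" using \<chi> assms by auto
  ultimately have "xsat T' a' (XDia_inv r \<chi>)" using assms unfolding type_eq_def by blast
  then show ?thesis using cells_agree[OF \<chi>] unfolding type_eq_def by auto
qed

text \<open>The defining formula is the disjunction of the finitely many cells realised together
  with \<open>Q\<close> somewhere in \<open>K\<close>. A node in one of these cells is equivalent to
  a node with \<open>Q\<close>, so invariance gives \<open>Q\<close> there.\<close>

lemma type_invariant_definable:
  assumes "\<And>T T' a a'. T \<in> K \<Longrightarrow> T' \<in> K \<Longrightarrow> a \<in> nodes T \<Longrightarrow> a' \<in> nodes T' \<Longrightarrow>
    type_eq ps k T a T' a' \<Longrightarrow> Q T a \<Longrightarrow> Q T' a'"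
  shows "\<exists>\<chi>. props \<chi> \<subseteq> set ps \<and> (\<forall>T\<in>K. \<forall>a\<in>nodes T. Q T a \<longleftrightarrow> xsat T a \<chi>)"
proof -
  let ?C = "cells (feats ps k)"
  let ?L = "filter (\<lambda>\<chi>. \<exists>T\<in>K. \<exists>a\<in>nodes T. Q T a \<and> xsat T a \<chi>) ?C"
  let ?\<chi> = "foldr XDisj ?L (XNeg XTop)"
  have sat: "xsat T a (foldr XDisj L (XNeg XTop)) \<longleftrightarrow> (\<exists>\<chi>\<in>set L. xsat T a \<chi>)" for T :: "'a tree" and a L
    by (induction L) auto
  have "props (foldr XDisj L (XNeg XTop)) = (\<Union>\<chi>\<in>set L. props \<chi>)" for L :: "'a xpath list"
    by (induction L) auto
  moreover have "props \<chi> \<subseteq> set ps" if "\<chi> \<in> set ?C" for \<chi>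
    using props_cells[OF that] props_feats by blast
  ultimately have "props ?\<chi> \<subseteq> set ps" by auto
  moreover have "Q T a \<longleftrightarrow> xsat T a ?\<chi>" if T: "T \<in> K" "a \<in> nodes T" for T a
  proof
    assume "Q T a"
    then show "xsat T a ?\<chi>" unfolding sat using cells_cover[of "feats ps k" T a] T by auto
  next
    assume "xsat T a ?\<chi>"
    then obtain \<chi> T' a' where *: "\<chi> \<in> set ?C" "xsat T a \<chi>" "T' \<in> K" "a' \<in> nodes T'" "Q T' a'" "xsat T' a' \<chi>"
      unfolding sat by auto
    then have "type_eq ps k T' a' T a" using cells_agree unfolding type_eq_def by blast
    then show "Q T a" using assms * T by blast
  qed
  ultimately show ?thesis by blast
qed

section \<open>Extending a node to a finite configuration\<close>

lemma trees_prefix: "T \<in> trees P \<Longrightarrow> \<alpha> @ \<beta> \<in> nodes T \<Longrightarrow> \<alpha> \<in> nodes T"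
proof (induction \<beta> rule: rev_induct)
  case (snoc i \<beta>)
  then show ?case unfolding trees_def by (auto simp flip: append_assoc)
qed auto

lemma trees_sibling: "T \<in> trees P \<Longrightarrow> \<alpha> @ [j] \<in> nodes T \<Longrightarrow> i \<le> j \<Longrightarrow> \<alpha> @ [i] \<in> nodes T"
proof (induction j)
  case (Suc j)
  then have "\<alpha> @ [j] \<in> nodes T" unfolding trees_def by force
  then show ?case using Suc by (cases "i = Suc j") auto
qed auto

text \<open>A descendant that is not a child is a descendant of a child, and similarly for siblings;
  hence two modal steps suffice.\<close>

lemma nav_rel_split:
  assumes "T \<in> trees P" "d \<in> nodes T" "nav_rel r c d" "\<not> nav_rel s c d"
    "(r, s) \<in> {(Descendant, Child), (Following_Sibling, Next_Sibling)}"
  shows "\<exists>e\<in>nodes T. nav_rel s c e \<and> nav_rel r e d"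
  using assms(5)
proof (elim insertE emptyE)
  assume "(r, s) = (Descendant, Child)"
  then obtain i \<beta> where "d = c @ i # \<beta>" "\<beta> \<noteq> []" "r = Descendant" "s = Child"
    using assms by (auto simp: neq_Nil_conv)
  then show ?thesis using assms trees_prefix[of T P "c @ [i]" \<beta>] by (intro bexI[of _ "c @ [i]"]) auto
next
  assume rs: "(r, s) = (Following_Sibling, Next_Sibling)"
  then obtain p i j where *: "c = p @ [i]" "d = p @ [j]" "i < j" using assms by auto
  then have "j \<noteq> Suc i" using assms rs by auto
  then show ?thesis using assms * rs trees_sibling[of T P p j "Suc i"]
    by (intro bexI[of _ "p @ [Suc i]"]) auto
qed

text \<open>A path of at least two basic steps is never a basic step. Together with
  \<open>nav_rel_basic\<close>, this recovers every relation from \<open>c\<close> to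
  \<open>d\<close> from the modal steps taken.\<close>

lemma nav_rel_compose:
  assumes "nav_rel s c e" "nav_rel r e d"
    "(r, s) \<in> {(Descendant, Child), (Following_Sibling, Next_Sibling)}"
  shows "nav_rel q c d \<longleftrightarrow> q = r"
  using assms by (cases q) auto

lemma nav_rel_basic:
  assumes "nav_rel s c d" "(r, s) \<in> {(Descendant, Child), (Following_Sibling, Next_Sibling)}"
  shows "nav_rel q c d \<longleftrightarrow> q = r \<or> q = s"
  using assms by (cases q) auto

lemma nav_rel_edge_cases:
  assumes "nav_rel q c d"
  obtains r s where "(r, s) \<in> {(Descendant, Child), (Following_Sibling, Next_Sibling)}" "nav_rel s c d"
  | r s where "(r, s) \<in> {(Descendant, Child), (Following_Sibling, Next_Sibling)}" "nav_rel r c d" "\<not> nav_rel s c d"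
  using nav_rel_cases[OF assms] by blast

text \<open>No single modality expresses that a descendant is not a child, or that a following
  sibling is not the next one. Passing through an intermediate node enforces it, at the price of a
  second level.\<close>

lemma edge_forth:
  assumes "T \<in> trees P" "type_eq ps (k + 2) T c T' c'" "d \<in> nodes T" "nav_rel q c d"
  shows "\<exists>d'\<in>nodes T'. type_eq ps k T d T' d' \<and> (\<forall>r. nav_rel r c' d' \<longleftrightarrow> nav_rel r c d)"
  using assms(4)
proof (cases rule: nav_rel_edge_cases)
  case (1 r s)
  have "type_eq ps (Suc k) T c T' c'" using type_eq_mono[OF assms(2)] by simp
  then obtain d' where "d' \<in> nodes T'" "nav_rel s c' d'" "type_eq ps k T d T' d'"
    using type_eq_forth assms(3) 1(2) by blast
  then show ?thesis using nav_rel_basic[OF _ 1(1)] 1(2) by blast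
next
  case (2 r s)
  obtain e where e: "e \<in> nodes T" "nav_rel s c e" "nav_rel r e d"
    using nav_rel_split[OF assms(1,3) 2(2,3,1)] by blast
  have "type_eq ps (Suc (Suc k)) T c T' c'" using assms(2) by simp
  then obtain e' where e': "e' \<in> nodes T'" "nav_rel s c' e'" "type_eq ps (Suc k) T e T' e'"
    using type_eq_forth e by blast
  then obtain d' where "d' \<in> nodes T'" "nav_rel r e' d'" "type_eq ps k T d T' d'"
    using type_eq_forth assms(3) e(3) by blast
  then show ?thesis using nav_rel_compose[OF _ _ 2(1)] e e' by blast
qed

text \<open>The same edge is followed from its far end by converse modalities, in the opposite
  order: first to the intermediate node \<open>e\<close> along \<open>r\<close>, then to
  \<open>c\<close> along \<open>s\<close>.\<close>

lemma edge_back: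
  assumes "T \<in> trees P" "type_eq ps (k + 2) T d T' d'" "c \<in> nodes T" "d \<in> nodes T" "nav_rel q c d"
  shows "\<exists>c'\<in>nodes T'. type_eq ps k T c T' c' \<and> (\<forall>r. nav_rel r c' d' \<longleftrightarrow> nav_rel r c d)"
  using assms(5)
proof (cases rule: nav_rel_edge_cases)
  case (1 r s)
  have "type_eq ps (Suc k) T d T' d'" using type_eq_mono[OF assms(2)] by simp
  then obtain c' where "c' \<in> nodes T'" "nav_rel s c' d'" "type_eq ps k T c T' c'"
    using type_eq_forth_inv assms(3) 1(2) by blast
  then show ?thesis using nav_rel_basic[OF _ 1(1)] 1(2) by blast
next
  case (2 r s)
  obtain e where e: "e \<in> nodes T" "nav_rel s c e" "nav_rel r e d"
    using nav_rel_split[OF assms(1,4) 2(2,3,1)] by blast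
  have "type_eq ps (Suc (Suc k)) T d T' d'" using assms(2) by simp
  then obtain e' where e': "e' \<in> nodes T'" "nav_rel r e' d'" "type_eq ps (Suc k) T e T' e'"
    using type_eq_forth_inv e by blast
  then obtain c' where "c' \<in> nodes T'" "nav_rel s c' e'" "type_eq ps k T c T' c'"
    using type_eq_forth_inv assms(3) e(2) by blast
  then show ?thesis using nav_rel_compose[OF _ _ 2(1)] e e' by blast
qed

section \<open>Embedding finite sets of nodes\<close>

definition embeds :: "'p list \<Rightarrow> nat \<Rightarrow> 'p tree \<Rightarrow> 'p tree \<Rightarrow> nat list set \<Rightarrow> (nat list \<Rightarrow> nat list) \<Rightarrow> bool" where
  "embeds ps k T T' D f \<longleftrightarrow> nav_iso D f \<and> (\<forall>b\<in>D. f b \<in> nodes T' \<and> type_eq ps k T b T' (f b))"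

lemma embeds_mono: "embeds ps l T T' E f \<Longrightarrow> k \<le> l \<Longrightarrow> D \<subseteq> E \<Longrightarrow> embeds ps k T T' D f"
  unfolding embeds_def nav_iso_def by (simp add: subset_iff del: nav_rel.simps) (metis type_eq_mono)

lemma embeds_inv_into:
  assumes "embeds ps k T T' D f" "D \<subseteq> nodes T"
  shows "embeds ps k T' T (f ` D) (inv_into D f)"
proof -
  have inj: "inj_on f D" using assms unfolding embeds_def nav_iso_def inj_on_def by blast
  have iso: "nav_iso D f" and ty: "\<And>b. b \<in> D \<Longrightarrow> type_eq ps k T b T' (f b)"
    using assms(1) unfolding embeds_def by auto
  have "nav_iso (f ` D) (inv_into D f)"
    unfolding nav_iso_def
  proof (intro ballI)
    fix x y assume "x \<in> f ` D" "y \<in> f ` D"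
    then obtain u w where "x = f u" "y = f w" "u \<in> D" "w \<in> D" by blast
    then show "(inv_into D f x = inv_into D f y \<longleftrightarrow> x = y) \<and>
      (\<forall>r. nav_rel r (inv_into D f x) (inv_into D f y) \<longleftrightarrow> nav_rel r x y)"
      using inj iso unfolding nav_iso_def by (simp del: nav_rel.simps)
  qed
  then show ?thesis
    unfolding embeds_def using inj assms(2) type_eq_sym[OF ty] by auto
qed

text \<open>Induction on the size of \<open>S\<close>: a leaf is removed, the rest is embedded, and
  the leaf is attached again along one edge. Each edge costs two levels, whence the summand
  \<open>2 * card S\<close>.\<close>

lemma embeds_branch_closed:
  assumes "T \<in> trees P" "finite S" "S \<subseteq> nodes T" "branch_closed S" "a \<in> S" "a' \<in> nodes T'"
    "type_eq ps (k + 2 * card S) T a T' a'"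
  shows "\<exists>f. embeds ps k T T' S f \<and> f a = a'"
  using assms(2-)
proof (induction "card S" arbitrary: S k a a')
  case 0
  then show ?case by auto
next
  case (Suc n)
  have ek: "type_eq ps k T a T' a'" using type_eq_mono[OF Suc.prems(6)] by simp
  show ?case
  proof (cases "S = {a}")
    case True
    have "embeds ps k T T' {a} (\<lambda>_. a')"
      unfolding embeds_def nav_iso_def using ek Suc.prems(5) nav_rel_irrefl by blast
    then show ?thesis using True by blast
  next
    case False
    then obtain b where b: "b \<in> S" "a \<noteq> b" using Suc.prems(4) by blast
    obtain c d where cd: "d \<in> S" "c \<in> S - {d}" "branch_closed (S - {d})" "\<exists>r. nav_rel r c d"
      and ext: "\<And>f d'. nav_iso (S - {d}) f \<Longrightarrow> (\<forall>r. nav_rel r (f c) d' \<longleftrightarrow> nav_rel r c d) \<Longrightarrow>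
        nav_iso S (f(d := d'))"
      using branch_closed_remove_leaf[OF Suc.prems(1,3,4) b] by metis
    obtain q where q: "nav_rel q c d" using cd by blast
    have n: "n = card (S - {d})" using Suc.hyps(2) cd by simp
    have IH: "\<exists>f. embeds ps k' T T' (S - {d}) f \<and> f x = x'"
      if "x \<in> S - {d}" "x' \<in> nodes T'" "type_eq ps (k' + 2 * n) T x T' x'" for k' x x'
    proof -
      have "finite (S - {d})" "S - {d} \<subseteq> nodes T" using Suc.prems(1,2) by auto
      then show ?thesis
        by (rule Suc.hyps(1)[OF n _ _ cd(3) that(1,2) that(3)[unfolded n]])
    qed
    show ?thesis
    proof (cases "a = d")
      case True
      \<comment> \<open>The node with prescribed image is the leaf itself. Two levels pay for the
        step back to \<open>c\<close>, and the rest is embedded around \<open>c\<close>.\<close>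
      have "type_eq ps ((k + 2 * n) + 2) T d T' a'"
        using Suc.prems(6) Suc.hyps(2)[symmetric] True by simp
      then obtain c' where c': "c' \<in> nodes T'" "type_eq ps (k + 2 * n) T c T' c'"
        "\<forall>r. nav_rel r c' a' \<longleftrightarrow> nav_rel r c d"
        using edge_back[OF assms(1) _ _ _ q] cd Suc.prems by blast
      then obtain f where "embeds ps k T T' (S - {d}) f" "f c = c'" using IH cd by blast
      moreover from this have "nav_iso S (f(d := a'))"
        using ext c'(3) unfolding embeds_def by blast
      ultimately have "embeds ps k T T' S (f(d := a'))"
        using ek Suc.prems(5) True unfolding embeds_def by simp
      then show ?thesis using True by (intro exI[of _ "f(d := a')"]) simp
    next
      case False
      \<comment> \<open>The rest is embedded first, but at depth \<open>k + 2\<close>, so that the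
        step from \<open>c\<close> to the leaf can still be matched at depth
        \<open>k\<close>.\<close>
      have "type_eq ps ((k + 2) + 2 * n) T a T' a'"
        using Suc.prems(6) Suc.hyps(2)[symmetric] by simp
      then obtain f where f: "embeds ps (k + 2) T T' (S - {d}) f" "f a = a'"
        using IH[of a a' "k + 2"] False Suc.prems by blast
      then obtain d' where d': "d' \<in> nodes T'" "type_eq ps k T d T' d'"
        "\<forall>r. nav_rel r (f c) d' \<longleftrightarrow> nav_rel r c d"
        using edge_forth[OF assms(1) _ _ q] cd Suc.prems unfolding embeds_def by blast
      have "embeds ps k T T' (S - {d}) f" using embeds_mono[OF f(1)] by simp
      moreover from this have "nav_iso S (f(d := d'))"
        using ext d'(3) unfolding embeds_def by blast
      ultimately have "embeds ps k T T' S (f(d := d'))"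
        using d' unfolding embeds_def by simp
      then show ?thesis using f False by (intro exI[of _ "f(d := d')"]) simp
    qed
  qed
qed

text \<open>The branch hull of \<open>S\<close> stays inside the tree and has at most
  \<open>2 * (n * n)\<close> nodes; at two levels per node this gives
  \<open>4 * (n * n)\<close>.\<close>

lemma embeds_extend:
  assumes "T \<in> trees P" "finite S" "S \<subseteq> nodes T" "card S \<le> n" "a \<in> S" "a' \<in> nodes T'"
    "type_eq ps (k + 4 * (n * n)) T a T' a'"
  shows "\<exists>f. embeds ps k T T' S f \<and> f a = a'"
proof -
  have "card (branch_hull S) \<le> 2 * (card S * card S)" using card_branch_hull assms(2) by blast
  also have "\<dots> \<le> 2 * (n * n)" using assms(4) by (simp add: mult_le_mono)
  finally have "type_eq ps (k + 2 * card (branch_hull S)) T a T' a'"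
    using type_eq_mono[OF assms(7)] by simp
  moreover have "branch_hull S \<subseteq> nodes T"
  proof
    fix x assume "x \<in> branch_hull S"
    then obtain y where "y \<in> S" "prefix x y" by (rule branch_hull_prefix)
    then show "x \<in> nodes T" using assms(1,3) trees_prefix by (metis prefix_def subsetD)
  qed
  ultimately obtain f where "embeds ps k T T' (branch_hull S) f" "f a = a'"
    using embeds_branch_closed[OF assms(1) finite_branch_hull[OF assms(2)] _ branch_closed_branch_hull _ assms(6)]
      subset_branch_hull assms(5) by blast
  then show ?thesis using embeds_mono subset_branch_hull by blast
qed

section \<open>Invariant formulas\<close>

lemma sat_cong: "(\<And>x. x \<in> fv \<phi> \<Longrightarrow> v x = w x) \<Longrightarrow> sat T v \<phi> \<longleftrightarrow> sat T w \<phi>"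
proof (induction \<phi> arbitrary: v w)
  case (Exists x \<phi>)
  have "sat T (v(x := a)) \<phi> \<longleftrightarrow> sat T (w(x := a)) \<phi>" for a
    using Exists.prems by (intro Exists.IH) auto
  then show ?case by simp
next
  case (Forall x \<phi>)
  have "sat T (v(x := a)) \<phi> \<longleftrightarrow> sat T (w(x := a)) \<phi>" for a
    using Forall.prems by (intro Forall.IH) auto
  then show ?case by simp
next
  case (Exists_ge C x \<phi>)
  have "sat T (v(x := a)) \<phi> \<longleftrightarrow> sat T (w(x := a)) \<phi>" for a
    using Exists_ge.prems by (intro Exists_ge.IH) auto
  then show ?case by simp
next
  case (Exists_le C x \<phi>)
  have "sat T (v(x := a)) \<phi> \<longleftrightarrow> sat T (w(x := a)) \<phi>" for a
    using Exists_le.prems by (intro Exists_le.IH) auto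
  then show ?case by simp
next
  case (Neg \<phi>)
  have "sat T v \<phi> \<longleftrightarrow> sat T w \<phi>" using Neg.prems by (intro Neg.IH) auto
  then show ?case by simp
next
  case (Conj \<phi> \<psi>)
  have "sat T v \<phi> \<longleftrightarrow> sat T w \<phi>" "sat T v \<psi> \<longleftrightarrow> sat T w \<psi>"
    using Conj.prems by (intro Conj.IH; simp)+
  then show ?case by simp
next
  case (Disj \<phi> \<psi>)
  have "sat T v \<phi> \<longleftrightarrow> sat T w \<phi>" "sat T v \<psi> \<longleftrightarrow> sat T w \<psi>"
    using Disj.prems by (intro Disj.IH; simp)+
  then show ?case by simp
next
  case (Impl \<phi> \<psi>)
  have "sat T v \<phi> \<longleftrightarrow> sat T w \<phi>" "sat T v \<psi> \<longleftrightarrow> sat T w \<psi>"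
    using Impl.prems by (intro Impl.IH; simp)+
  then show ?case by simp
qed auto

lemma finite_fv: "finite (fv \<phi>)"
  by (induction \<phi>) auto

lemma fv_subset_vars: "fv \<phi> \<subseteq> vars \<phi>"
  by (induction \<phi>) auto

lemma fv_foldr_Exists: "fv (foldr Exists xs \<phi>) = fv \<phi> - set xs"
  by (induction xs) auto

lemma preds_foldr_Exists: "preds (foldr Exists xs \<phi>) = preds \<phi>"
  by (induction xs) auto

lemma sat_foldr_Exists:
  "sat T v (foldr Exists xs \<phi>) \<longleftrightarrow>
     (\<exists>u. (\<forall>z. z \<notin> set xs \<longrightarrow> u z = v z) \<and> u ` set xs \<subseteq> nodes T \<and> sat T u \<phi>)"
proof (induction xs arbitrary: v)
  case Nil
  have "u = v" if "\<forall>z. u z = v z" for u using that by auto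
  then show ?case by auto
next
  case (Cons x xs)
  show ?case
  proof
    assume "sat T v (foldr Exists (x # xs) \<phi>)"
    then obtain a u where u: "a \<in> nodes T" "\<forall>z. z \<notin> set xs \<longrightarrow> u z = (v(x := a)) z"
      "u ` set xs \<subseteq> nodes T" "sat T u \<phi>"
      using Cons.IH by auto
    then have "u x \<in> nodes T" by (cases "x \<in> set xs") auto
    then show "\<exists>u. (\<forall>z. z \<notin> set (x # xs) \<longrightarrow> u z = v z) \<and> u ` set (x # xs) \<subseteq> nodes T \<and> sat T u \<phi>"
      using u by (intro exI[of _ u]) auto
  next
    assume "\<exists>u. (\<forall>z. z \<notin> set (x # xs) \<longrightarrow> u z = v z) \<and> u ` set (x # xs) \<subseteq> nodes T \<and> sat T u \<phi>"
    then obtain u where u: "\<forall>z. z \<notin> set (x # xs) \<longrightarrow> u z = v z" "u ` set (x # xs) \<subseteq> nodes T" "sat T u \<phi>"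
      by blast
    then have "sat T (v(x := u x)) (foldr Exists xs \<phi>)"
      unfolding Cons.IH by (intro exI[of _ u]) auto
    then show "sat T v (foldr Exists (x # xs) \<phi>)" using u by auto
  qed
qed

text \<open>A nonempty \<open>V\<close> gives even a closed formula a node around which witnesses
  can be embedded. Letting \<open>V\<close> exceed the free variables allows subformulas with
  different free variables to be treated together.\<close>

definition invariant :: "'p list \<Rightarrow> 'p fm \<Rightarrow> bool" where
  "invariant ps \<phi> \<longleftrightarrow> (\<forall>V. V \<noteq> {} \<longrightarrow> fv \<phi> \<subseteq> V \<longrightarrow> (\<exists>k. \<forall>T\<in>trees (set ps). \<forall>T'\<in>trees (set ps). \<forall>v f.
     v ` V \<subseteq> nodes T \<longrightarrow> embeds ps k T T' (v ` V) f \<longrightarrow> (sat T v \<phi> \<longleftrightarrow> sat T' (f \<circ> v) \<phi>)))"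

text \<open>Applying the hypothesis to \<open>f\<close> and to its inverse gives both directions of the equivalence.\<close>

lemma invariantI:
  assumes "\<And>V. V \<noteq> {} \<Longrightarrow> fv \<phi> \<subseteq> V \<Longrightarrow> \<exists>k. \<forall>T\<in>trees (set ps). \<forall>T'\<in>trees (set ps). \<forall>v f.
     v ` V \<subseteq> nodes T \<longrightarrow> embeds ps k T T' (v ` V) f \<longrightarrow> sat T v \<phi> \<longrightarrow> sat T' (f \<circ> v) \<phi>"
  shows "invariant ps \<phi>"
  unfolding invariant_def
proof (intro allI impI)
  fix V :: "nat set"
  assume V: "V \<noteq> {}" "fv \<phi> \<subseteq> V"
  then obtain k where k: "\<And>T T' v f. T \<in> trees (set ps) \<Longrightarrow> T' \<in> trees (set ps) \<Longrightarrow> v ` V \<subseteq> nodes T \<Longrightarrow>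
     embeds ps k T T' (v ` V) f \<Longrightarrow> sat T v \<phi> \<Longrightarrow> sat T' (f \<circ> v) \<phi>"
    using assms by meson
  have "sat T v \<phi> \<longleftrightarrow> sat T' (f \<circ> v) \<phi>"
    if T: "T \<in> trees (set ps)" "T' \<in> trees (set ps)" "v ` V \<subseteq> nodes T" "embeds ps k T T' (v ` V) f" for T T' v f
  proof
    assume "sat T' (f \<circ> v) \<phi>"
    moreover have "(f \<circ> v) ` V \<subseteq> nodes T'" using T(4) unfolding embeds_def by auto
    moreover have "embeds ps k T' T ((f \<circ> v) ` V) (inv_into (v ` V) f)"
      using embeds_inv_into[OF T(4,3)] by (simp add: image_comp)
    ultimately have s: "sat T (inv_into (v ` V) f \<circ> (f \<circ> v)) \<phi>" using k T by blast
    have "inj_on f (v ` V)" using T(4) unfolding embeds_def nav_iso_def inj_on_def by blast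
    then have "(inv_into (v ` V) f \<circ> (f \<circ> v)) x = v x" if "x \<in> fv \<phi>" for x
      using that V by auto
    then show "sat T v \<phi>" using s sat_cong by blast
  qed (use k T in blast)
  then show "\<exists>k. \<forall>T\<in>trees (set ps). \<forall>T'\<in>trees (set ps). \<forall>v f.
     v ` V \<subseteq> nodes T \<longrightarrow> embeds ps k T T' (v ` V) f \<longrightarrow> sat T v \<phi> \<longleftrightarrow> sat T' (f \<circ> v) \<phi>"
    by blast
qed

text \<open>Embeddings at a greater depth are also embeddings at a smaller one, so several depth
  bounds can be replaced by their maximum.\<close>

lemma invariant_eventually:
  assumes "invariant ps \<phi>" "V \<noteq> {}" "fv \<phi> \<subseteq> V"
  shows "\<exists>k. \<forall>l\<ge>k. \<forall>T\<in>trees (set ps). \<forall>T'\<in>trees (set ps). \<forall>v f. v ` V \<subseteq> nodes T \<longrightarrow>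
     embeds ps l T T' (v ` V) f \<longrightarrow> sat T v \<phi> \<longleftrightarrow> sat T' (f \<circ> v) \<phi>"
proof -
  obtain k where "\<forall>T\<in>trees (set ps). \<forall>T'\<in>trees (set ps). \<forall>v f.
     v ` V \<subseteq> nodes T \<longrightarrow> embeds ps k T T' (v ` V) f \<longrightarrow> sat T v \<phi> \<longleftrightarrow> sat T' (f \<circ> v) \<phi>"
    using assms unfolding invariant_def by meson
  then show ?thesis
    by (intro exI[of _ k] allI impI ballI) (metis embeds_mono subset_refl)
qed

section \<open>Closure of invariance under connectives and quantifiers\<close>

lemma invariant_Unary: "p \<in> set ps \<Longrightarrow> invariant ps (Unary p x)"
  unfolding invariant_def embeds_def by (auto dest: type_eq_label)

lemma invariant_Nav: "invariant ps (Nav r x y)"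
  unfolding invariant_def embeds_def nav_iso_def by (simp del: nav_rel.simps)

lemma invariant_Eql: "invariant ps (Eql x y)"
  unfolding invariant_def embeds_def nav_iso_def by (simp del: nav_rel.simps)

lemma invariant_cong:
  assumes "invariant ps \<phi>" "fv \<psi> = fv \<phi>" "\<And>T v. sat T v \<psi> \<longleftrightarrow> sat T v \<phi>"
  shows "invariant ps \<psi>"
  using assms unfolding invariant_def by simp

lemma invariant_Neg: "invariant ps \<phi> \<Longrightarrow> invariant ps (Neg \<phi>)"
  unfolding invariant_def by simp

lemma invariant_Disj:
  assumes "invariant ps \<phi>" "invariant ps \<psi>"
  shows "invariant ps (Disj \<phi> \<psi>)"
  unfolding invariant_def
proof (intro allI impI)
  fix V :: "nat set"
  assume V: "V \<noteq> {}" "fv (Disj \<phi> \<psi>) \<subseteq> V"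
  obtain k where k: "\<And>i T T' v f. k \<le> i \<Longrightarrow> T \<in> trees (set ps) \<Longrightarrow> T' \<in> trees (set ps) \<Longrightarrow> v ` V \<subseteq> nodes T \<Longrightarrow>
     embeds ps i T T' (v ` V) f \<Longrightarrow> sat T v \<phi> \<longleftrightarrow> sat T' (f \<circ> v) \<phi>"
    using invariant_eventually[OF assms(1) V(1)] V(2) by simp metis
  obtain l where l: "\<And>i T T' v f. l \<le> i \<Longrightarrow> T \<in> trees (set ps) \<Longrightarrow> T' \<in> trees (set ps) \<Longrightarrow> v ` V \<subseteq> nodes T \<Longrightarrow>
     embeds ps i T T' (v ` V) f \<Longrightarrow> sat T v \<psi> \<longleftrightarrow> sat T' (f \<circ> v) \<psi>"
    using invariant_eventually[OF assms(2) V(1)] V(2) by simp metis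
  show "\<exists>k. \<forall>T\<in>trees (set ps). \<forall>T'\<in>trees (set ps). \<forall>v f.
     v ` V \<subseteq> nodes T \<longrightarrow> embeds ps k T T' (v ` V) f \<longrightarrow> sat T v (Disj \<phi> \<psi>) \<longleftrightarrow> sat T' (f \<circ> v) (Disj \<phi> \<psi>)"
    using k[of "max k l"] l[of "max k l"] by (intro exI[of _ "max k l"]) simp
qed

lemma invariant_Conj: "invariant ps \<phi> \<Longrightarrow> invariant ps \<psi> \<Longrightarrow> invariant ps (Conj \<phi> \<psi>)"
  by (rule invariant_cong[OF invariant_Neg[OF invariant_Disj[OF invariant_Neg invariant_Neg]]]) auto

lemma invariant_Impl: "invariant ps \<phi> \<Longrightarrow> invariant ps \<psi> \<Longrightarrow> invariant ps (Impl \<phi> \<psi>)"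
  by (rule invariant_cong[OF invariant_Disj[OF invariant_Neg]]) auto

text \<open>At most one variable of \<open>\<phi>\<close> lies outside the block. So
  \<open>f\<close> matters at a single node only, and all witnesses can be embedded afresh around
  that node.\<close>

lemma invariant_foldr_Exists:
  assumes "invariant ps \<phi>" "fv \<phi> \<subseteq> insert w (set xs)"
  shows "invariant ps (foldr Exists xs \<phi>)"
proof (rule invariantI)
  fix V :: "nat set"
  assume V: "V \<noteq> {}" "fv (foldr Exists xs \<phi>) \<subseteq> V"
  \<comment> \<open>If \<open>w\<close> is not in \<open>V\<close>, all free variables of
    \<open>\<phi>\<close> are bound by the block, and any element of \<open>V\<close> can serve as
    anchor.\<close>
  obtain z where z: "z \<in> V" "fv \<phi> \<subseteq> insert z (set xs)"
  proof (cases "w \<in> V")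
    case False
    then have "fv \<phi> \<subseteq> set xs" using V(2) assms(2) by (auto simp: fv_foldr_Exists)
    then show ?thesis using V(1) that by blast
  qed (use assms(2) that in blast)
  let ?W = "insert z (set xs)"
  obtain k where k: "\<And>T T' v f. T \<in> trees (set ps) \<Longrightarrow> T' \<in> trees (set ps) \<Longrightarrow> v ` ?W \<subseteq> nodes T \<Longrightarrow>
     embeds ps k T T' (v ` ?W) f \<Longrightarrow> sat T v \<phi> \<Longrightarrow> sat T' (f \<circ> v) \<phi>"
    using invariant_eventually[OF assms(1) insert_not_empty z(2)] by (elim exE) blast
  \<comment> \<open>The set to embed holds \<open>v z\<close> and the values of \<open>u\<close> at
    \<open>z\<close> and at \<open>xs\<close>; \<open>v z\<close> and \<open>u z\<close> may differ
    if the block rebinds \<open>z\<close>.\<close>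
  let ?n = "length xs + 2"
  have "sat T' (f \<circ> v) (foldr Exists xs \<phi>)"
    if T: "T \<in> trees (set ps)" "T' \<in> trees (set ps)" "v ` V \<subseteq> nodes T"
      "embeds ps (k + 4 * (?n * ?n)) T T' (v ` V) f" and s: "sat T v (foldr Exists xs \<phi>)" for T T' v f
  proof -
    obtain u where u: "\<forall>y. y \<notin> set xs \<longrightarrow> u y = v y" "u ` set xs \<subseteq> nodes T" "sat T u \<phi>"
      using s unfolding sat_foldr_Exists by blast
    let ?S = "insert (v z) (u ` ?W)"
    have vz: "v z \<in> nodes T" using T(3) z(1) by blast
    have "u z \<in> nodes T"
    proof (cases "z \<in> set xs")
      case False
      then have "u z = v z" using u(1) by blast
      then show ?thesis using vz by simp
    qed (use u(2) in blast)
    then have sub: "?S \<subseteq> nodes T" using u(2) vz by simp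
    have "card (u ` ?W) \<le> Suc (length xs)"
      using card_image_le[of ?W u] card_insert_le_m1[of "Suc (length xs)" "set xs" z] card_length[of xs]
      by simp
    then have crd: "card ?S \<le> ?n" by (intro order_trans[OF card_insert_le_m1]) auto
    have "finite ?S" by simp
    moreover have "f (v z) \<in> nodes T'" "type_eq ps (k + 4 * (?n * ?n)) T (v z) T' (f (v z))"
      using T(4) z(1) unfolding embeds_def by auto
    ultimately obtain g where g: "embeds ps k T T' ?S g" "g (v z) = f (v z)"
      using embeds_extend[OF T(1) _ sub crd insertI1] by blast
    have "embeds ps k T T' (u ` ?W) g" using embeds_mono[OF g(1) order_refl subset_insertI] .
    moreover have "u ` ?W \<subseteq> nodes T" using sub by (rule subset_trans[OF subset_insertI])
    ultimately have s': "sat T' (g \<circ> u) \<phi>" using k[OF T(1,2) _ _ u(3)] by blast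
    \<comment> \<open>Quantified variables take their values through \<open>g\<close>, the others
      through \<open>f\<close>. The only free variable of \<open>\<phi>\<close> that can lie outside
      the block is \<open>z\<close>, where \<open>g\<close> and \<open>f\<close> agree on
      \<open>v z\<close>.\<close>
    let ?u = "\<lambda>y. if y \<in> set xs then g (u y) else f (v y)"
    have "(g \<circ> u) y = ?u y" if "y \<in> fv \<phi>" for y
    proof (cases "y \<in> set xs")
      case False
      then have "y = z" using that z(2) by blast
      then show ?thesis using False u(1) g(2) by simp
    qed simp
    then have "sat T' ?u \<phi>" using s' sat_cong[of \<phi> "g \<circ> u" ?u T'] by blast
    moreover have "?u ` set xs \<subseteq> nodes T'" using g(1) unfolding embeds_def by auto
    moreover have "\<forall>y. y \<notin> set xs \<longrightarrow> ?u y = (f \<circ> v) y" by simp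
    ultimately show ?thesis unfolding sat_foldr_Exists by (intro exI[of _ ?u] conjI)
  qed
  then show "\<exists>k. \<forall>T\<in>trees (set ps). \<forall>T'\<in>trees (set ps). \<forall>v f. v ` V \<subseteq> nodes T \<longrightarrow>
    embeds ps k T T' (v ` V) f \<longrightarrow> sat T v (foldr Exists xs \<phi>) \<longrightarrow> sat T' (f \<circ> v) (foldr Exists xs \<phi>)"
    by blast
qed

text \<open>An embedding is injective, so \<open>C\<close> witnesses are mapped to \<open>C\<close> distinct witnesses.\<close>

lemma invariant_Exists_ge:
  assumes "invariant ps \<phi>" "fv \<phi> \<subseteq> {w, x}"
  shows "invariant ps (Exists_ge C x \<phi>)"
proof (rule invariantI)
  fix V :: "nat set"
  assume V: "V \<noteq> {}" "fv (Exists_ge C x \<phi>) \<subseteq> V"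
  obtain z where z: "z \<in> V" "fv \<phi> \<subseteq> {z, x}"
    using V assms(2) by fastforce
  obtain k where k: "\<And>T T' v f. T \<in> trees (set ps) \<Longrightarrow> T' \<in> trees (set ps) \<Longrightarrow> v ` {z, x} \<subseteq> nodes T \<Longrightarrow>
     embeds ps k T T' (v ` {z, x}) f \<Longrightarrow> sat T v \<phi> \<Longrightarrow> sat T' (f \<circ> v) \<phi>"
    using invariant_eventually[OF assms(1) insert_not_empty z(2)] by (elim exE) blast
  \<comment> \<open>There are \<open>C\<close> witnesses and one anchor.\<close>
  let ?n = "Suc C"
  have "sat T' (f \<circ> v) (Exists_ge C x \<phi>)"
    if T: "T \<in> trees (set ps)" "T' \<in> trees (set ps)" "v ` V \<subseteq> nodes T"
      "embeds ps (k + 4 * (?n * ?n)) T T' (v ` V) f" and s: "sat T v (Exists_ge C x \<phi>)" for T T' v f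
  proof -
    obtain A where A: "A \<subseteq> {a \<in> nodes T. sat T (v(x := a)) \<phi>}" "card A = C" "finite A"
      using s obtain_subset_with_card_n[of C "{a \<in> nodes T. sat T (v(x := a)) \<phi>}"] by auto
    let ?S = "insert (v z) A"
    have sub: "?S \<subseteq> nodes T" using A T(3) z(1) by auto
    have crd: "card ?S \<le> ?n" using A(2,3) by (simp add: card_insert_if)
    have "finite ?S" using A(3) by simp
    moreover have "f (v z) \<in> nodes T'" "type_eq ps (k + 4 * (?n * ?n)) T (v z) T' (f (v z))"
      using T(4) z(1) unfolding embeds_def by auto
    ultimately obtain g where g: "embeds ps k T T' ?S g" "g (v z) = f (v z)"
      using embeds_extend[OF T(1) _ sub crd insertI1] by blast
    have "g a \<in> {a \<in> nodes T'. sat T' ((f \<circ> v)(x := a)) \<phi>}" if a: "a \<in> A" for a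
    proof -
      have i: "(v(x := a)) ` {z, x} \<subseteq> ?S" using a by auto
      have "embeds ps k T T' ((v(x := a)) ` {z, x}) g" using embeds_mono[OF g(1) _ i] by blast
      then have "sat T' (g \<circ> v(x := a)) \<phi>" 
        using k[OF T(1,2) subset_trans[OF i sub]] a A(1) by blast
      moreover have "(g \<circ> v(x := a)) y = ((f \<circ> v)(x := g a)) y" if "y \<in> fv \<phi>" for y
        using that z(2) g(2) by auto
      ultimately have "sat T' ((f \<circ> v)(x := g a)) \<phi>" using sat_cong by blast
      then show ?thesis using g(1) a unfolding embeds_def by auto
    qed
    then have im: "g ` A \<subseteq> {a \<in> nodes T'. sat T' ((f \<circ> v)(x := a)) \<phi>}" by blast
    have "inj_on g A" using g(1) unfolding embeds_def nav_iso_def inj_on_def by blast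
    then have "card (g ` A) = C" using A(2) by (simp add: card_image)
    moreover have "finite {a \<in> nodes T'. sat T' ((f \<circ> v)(x := a)) \<phi>}" using T(2) unfolding trees_def by simp
    ultimately show ?thesis using card_mono[OF _ im] by (simp only: sat.simps) 
  qed
  then show "\<exists>k. \<forall>T\<in>trees (set ps). \<forall>T'\<in>trees (set ps). \<forall>v f. v ` V \<subseteq> nodes T \<longrightarrow>
    embeds ps k T T' (v ` V) f \<longrightarrow> sat T v (Exists_ge C x \<phi>) \<longrightarrow> sat T' (f \<circ> v) (Exists_ge C x \<phi>)"
    by blast
qed

text \<open>With two variables in total, binding one leaves at most the other free, so each
  quantifier meets the one-outer-variable condition. \<open>Exists_le C\<close> is the negation of
  \<open>Exists_ge (Suc C)\<close>.\<close>

lemma invariant_C2: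
  "vars \<phi> \<subseteq> {x, y} \<Longrightarrow> preds \<phi> \<subseteq> set ps \<Longrightarrow> invariant ps \<phi>"
proof (induction \<phi>)
  case (Exists z \<phi>)
  have "fv \<phi> \<subseteq> insert (if z = x then y else x) (set [z])" using Exists.prems fv_subset_vars[of \<phi>] by auto
  from invariant_foldr_Exists[OF _ this, of ps] show ?case using Exists by simp
next
  case (Forall z \<phi>)
  have "fv (Neg \<phi>) \<subseteq> insert (if z = x then y else x) (set [z])" using Forall.prems fv_subset_vars[of \<phi>] by auto
  from invariant_foldr_Exists[OF _ this, of ps] have "invariant ps (Neg (Exists z (Neg \<phi>)))"
    using Forall by (auto intro: invariant_Neg)
  then show ?case by (rule invariant_cong) auto
next
  case (Exists_ge C z \<phi>)
  have "fv \<phi> \<subseteq> {if z = x then y else x, z}" using Exists_ge.prems fv_subset_vars[of \<phi>] by auto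
  from invariant_Exists_ge[OF _ this, of ps] show ?case using Exists_ge by simp
next
  case (Exists_le C z \<phi>)
  have "fv \<phi> \<subseteq> {if z = x then y else x, z}" using Exists_le.prems fv_subset_vars[of \<phi>] by auto
  from invariant_Exists_ge[OF _ this, of ps] have "invariant ps (Neg (Exists_ge (Suc C) z \<phi>))"
    using Exists_le by (auto intro: invariant_Neg)
  then show ?case by (rule invariant_cong) auto
qed (auto intro: invariant_Unary invariant_Nav invariant_Eql invariant_Neg invariant_Conj
      invariant_Disj invariant_Impl simp del: nav_rel.simps)

text \<open>Both quantifier rules leave at most the head variable \<open>x\<close> outside the
  block.\<close>

lemma invariant_F1: "wff_F1 \<phi> \<Longrightarrow> preds \<phi> \<subseteq> set ps \<Longrightarrow> invariant ps \<phi>"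
proof (induction rule: wff_F1.induct)
  case (6 \<phi> x xs)
  then have "invariant ps \<phi>" unfolding preds_foldr_Exists by blast
  then show ?case by (rule invariant_foldr_Exists[where w = x]) (use 6 in auto)
next
  case (7 \<phi> x xs)
  then have "invariant ps \<phi>" unfolding preds_foldr_Exists by blast
  then show ?case by (rule invariant_foldr_Exists[where w = x]) (use 7 in auto)
qed (auto intro: invariant_Unary invariant_Nav invariant_Eql invariant_Neg invariant_Disj)

definition definable :: "'p list \<Rightarrow> 'p fm \<Rightarrow> bool" where
  "definable ps \<phi> \<longleftrightarrow> (\<exists>\<chi>. props \<chi> \<subseteq> set ps \<and>
     (\<forall>T\<in>trees (set ps). \<forall>a\<in>nodes T. sat T (\<lambda>_. a) \<phi> \<longleftrightarrow> xsat T a \<chi>))"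

text \<open>On a single node, agreement of types already makes the map an embedding, since no node
  is related to itself. Invariance with \<open>V = {x}\<close> thus becomes invariance under
  \<open>type_eq\<close>.\<close>

lemma invariant_definable:
  assumes "invariant ps \<phi>" "fv \<phi> \<subseteq> {x}"
  shows "definable ps \<phi>"
proof -
  obtain k where k: "\<And>T T' v f. T \<in> trees (set ps) \<Longrightarrow> T' \<in> trees (set ps) \<Longrightarrow> v ` {x} \<subseteq> nodes T \<Longrightarrow>
     embeds ps k T T' (v ` {x}) f \<Longrightarrow> sat T v \<phi> \<longleftrightarrow> sat T' (f \<circ> v) \<phi>"
    using invariant_eventually[OF assms(1) insert_not_empty assms(2)] by (elim exE) blast
  show ?thesis
    unfolding definable_def
  proof (rule type_invariant_definable)
    fix T T' :: "'a tree" and a a'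
    assume *: "T \<in> trees (set ps)" "T' \<in> trees (set ps)" "a \<in> nodes T" "a' \<in> nodes T'"
      "type_eq ps k T a T' a'" "sat T (\<lambda>_. a) \<phi>"
    then have "embeds ps k T T' ((\<lambda>_. a) ` {x}) (\<lambda>_. a')"
      unfolding embeds_def nav_iso_def by (simp add: nav_rel_irrefl del: nav_rel.simps)
    then have "sat T' ((\<lambda>_. a') \<circ> (\<lambda>_. a)) \<phi>" using k[of T T' "\<lambda>_. a" "\<lambda>_. a'"] * by blast
    then show "sat T' (\<lambda>_. a') \<phi>" by (simp add: comp_def)
  qed
qed

section \<open>Unary negation formulas\<close>

lemma root_in_tree: "T \<in> trees P \<Longrightarrow> [] \<in> nodes T"
  using trees_prefix[of T P "[]"] unfolding trees_def by auto

text \<open>A weakening of invariance that is preserved by existential quantification: truth is only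
  preserved by embeddings defined on a bounded set \<open>S\<close> of witnesses.\<close>

definition supports :: "'p list \<Rightarrow> nat \<Rightarrow> 'p fm \<Rightarrow> 'p tree \<Rightarrow> (nat \<Rightarrow> nat list) \<Rightarrow> nat list set \<Rightarrow> bool" where
  "supports ps k \<phi> T v S \<longleftrightarrow> S \<subseteq> nodes T \<and> finite S \<and>
     (\<forall>T'\<in>trees (set ps). \<forall>f. embeds ps k T T' (v ` fv \<phi> \<union> S) f \<longrightarrow> sat T' (f \<circ> v) \<phi>)"

text \<open>The bounds are uniform in the tree and the assignment; \<open>m\<close> later determines
  how deep types must agree for the witnesses to be embedded. Only truth is transferred, so this
  notion is one-sided.\<close>

definition witnessed :: "'p list \<Rightarrow> 'p fm \<Rightarrow> bool" where
  "witnessed ps \<phi> \<longleftrightarrow> (\<exists>k m. \<forall>T\<in>trees (set ps). \<forall>v. v ` fv \<phi> \<subseteq> nodes T \<longrightarrow> sat T v \<phi> \<longrightarrow>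
     (\<exists>S. card S \<le> m \<and> supports ps k \<phi> T v S))"

lemma supportsD:
  assumes "supports ps k \<phi> T v S" "T' \<in> trees (set ps)" "embeds ps l T T' D f" "k \<le> l" "v ` fv \<phi> \<union> S \<subseteq> D"
  shows "sat T' (f \<circ> v) \<phi>"
  using assms(1,2) embeds_mono[OF assms(3-5)] unfolding supports_def by blast

lemma invariant_witnessed:
  assumes "invariant ps \<phi>"
  shows "witnessed ps \<phi>"
proof -
  obtain k where k: "\<And>T T' v f. T \<in> trees (set ps) \<Longrightarrow> T' \<in> trees (set ps) \<Longrightarrow> range v \<subseteq> nodes T \<Longrightarrow>
     embeds ps k T T' (range v) f \<Longrightarrow> sat T v \<phi> \<Longrightarrow> sat T' (f \<circ> v) \<phi>"
    using invariant_eventually[OF assms UNIV_not_empty subset_UNIV] by (elim exE) blast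
  have "\<exists>S. card S \<le> 1 \<and> supports ps k \<phi> T v S"
    if T: "T \<in> trees (set ps)" "v ` fv \<phi> \<subseteq> nodes T" "sat T v \<phi>" for T v
  proof -
    \<comment> \<open>Values at variables that are not free may lie outside the tree. The root
      replaces them and is the single witness, so invariance can be applied with all variables, also
      to closed formulas.\<close>
    let ?v = "\<lambda>y. if y \<in> fv \<phi> then v y else []"
    have r: "range ?v \<subseteq> v ` fv \<phi> \<union> {[]}" by auto
    have root: "{[]} \<subseteq> nodes T" using root_in_tree[OF T(1)] by simp
    have sub: "range ?v \<subseteq> nodes T" using r T(2) root by (meson Un_least subset_trans)
    have s: "sat T ?v \<phi>" using T(3) sat_cong[of \<phi> ?v v T] by simp
    have "sat T' (f \<circ> v) \<phi>" if T': "T' \<in> trees (set ps)" "embeds ps k T T' (v ` fv \<phi> \<union> {[]}) f" for T' f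
    proof -
      have "sat T' (f \<circ> ?v) \<phi>"
        by (rule k[OF T(1) T'(1) sub embeds_mono[OF T'(2) order_refl r] s])
      then show ?thesis using sat_cong[of \<phi> "f \<circ> ?v" "f \<circ> v" T'] by simp
    qed
    then have "supports ps k \<phi> T v {[]}" using root unfolding supports_def by blast
    then show ?thesis by (intro exI[of _ "{[]}"]) simp
  qed
  then show ?thesis unfolding witnessed_def by blast
qed

lemma witnessed_Disj:
  assumes "witnessed ps \<phi>" "witnessed ps \<psi>"
  shows "witnessed ps (Disj \<phi> \<psi>)"
proof -
  obtain k m where km: "\<And>T v. T \<in> trees (set ps) \<Longrightarrow> v ` fv \<phi> \<subseteq> nodes T \<Longrightarrow> sat T v \<phi> \<Longrightarrow>
    \<exists>S. card S \<le> m \<and> supports ps k \<phi> T v S"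
    using assms(1) unfolding witnessed_def by blast
  obtain k' m' where km': "\<And>T v. T \<in> trees (set ps) \<Longrightarrow> v ` fv \<psi> \<subseteq> nodes T \<Longrightarrow> sat T v \<psi> \<Longrightarrow>
    \<exists>S. card S \<le> m' \<and> supports ps k' \<psi> T v S"
    using assms(2) unfolding witnessed_def by blast
  let ?k = "max k k'"
  have "\<exists>S. card S \<le> max m m' \<and> supports ps ?k (Disj \<phi> \<psi>) T v S"
    if T: "T \<in> trees (set ps)" "v ` fv (Disj \<phi> \<psi>) \<subseteq> nodes T" "sat T v (Disj \<phi> \<psi>)" for T v
  proof (cases "sat T v \<phi>")
    case True
    have "v ` fv \<phi> \<subseteq> nodes T" using T(2) by auto
    from km[OF T(1) this True] obtain S where S: "card S \<le> m" "supports ps k \<phi> T v S" by blast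
    have "sat T' (f \<circ> v) \<phi>"
      if "T' \<in> trees (set ps)" "embeds ps ?k T T' (v ` fv (Disj \<phi> \<psi>) \<union> S) f" for T' f
      using supportsD[OF S(2) that] by auto
    then have "supports ps ?k (Disj \<phi> \<psi>) T v S" using S(2) unfolding supports_def by simp
    then show ?thesis using S(1) by (intro exI[of _ S]) simp
  next
    case False
    then have s: "sat T v \<psi>" using T(3) by simp
    have "v ` fv \<psi> \<subseteq> nodes T" using T(2) by auto
    from km'[OF T(1) this s] obtain S where S: "card S \<le> m'" "supports ps k' \<psi> T v S" by blast
    have "sat T' (f \<circ> v) \<psi>"
      if "T' \<in> trees (set ps)" "embeds ps ?k T T' (v ` fv (Disj \<phi> \<psi>) \<union> S) f" for T' f
      using supportsD[OF S(2) that] by auto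
    then have "supports ps ?k (Disj \<phi> \<psi>) T v S" using S(2) unfolding supports_def by simp
    then show ?thesis using S(1) by (intro exI[of _ S]) simp
  qed
  then show ?thesis unfolding witnessed_def by blast
qed

text \<open>One embedding of the union of both witness sets serves both conjuncts, so the sizes add
  up.\<close>

lemma witnessed_Conj:
  assumes "witnessed ps \<phi>" "witnessed ps \<psi>"
  shows "witnessed ps (Conj \<phi> \<psi>)"
proof -
  obtain k m where km: "\<And>T v. T \<in> trees (set ps) \<Longrightarrow> v ` fv \<phi> \<subseteq> nodes T \<Longrightarrow> sat T v \<phi> \<Longrightarrow>
    \<exists>S. card S \<le> m \<and> supports ps k \<phi> T v S"
    using assms(1) unfolding witnessed_def by blast
  obtain k' m' where km': "\<And>T v. T \<in> trees (set ps) \<Longrightarrow> v ` fv \<psi> \<subseteq> nodes T \<Longrightarrow> sat T v \<psi> \<Longrightarrow>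
    \<exists>S. card S \<le> m' \<and> supports ps k' \<psi> T v S"
    using assms(2) unfolding witnessed_def by blast
  let ?k = "max k k'"
  have "\<exists>S. card S \<le> m + m' \<and> supports ps ?k (Conj \<phi> \<psi>) T v S"
    if T: "T \<in> trees (set ps)" "v ` fv (Conj \<phi> \<psi>) \<subseteq> nodes T" "sat T v (Conj \<phi> \<psi>)" for T v
  proof -
    have s: "v ` fv \<phi> \<subseteq> nodes T" "v ` fv \<psi> \<subseteq> nodes T" "sat T v \<phi>" "sat T v \<psi>" using T(2,3) by auto
    from km[OF T(1) s(1,3)] obtain S where S: "card S \<le> m" "supports ps k \<phi> T v S" by blast
    from km'[OF T(1) s(2,4)] obtain S' where S': "card S' \<le> m'" "supports ps k' \<psi> T v S'" by blast
    have "sat T' (f \<circ> v) (Conj \<phi> \<psi>)"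
      if "T' \<in> trees (set ps)" "embeds ps ?k T T' (v ` fv (Conj \<phi> \<psi>) \<union> (S \<union> S')) f" for T' f
      using supportsD[OF S(2) that] supportsD[OF S'(2) that] by auto
    then have "supports ps ?k (Conj \<phi> \<psi>) T v (S \<union> S')"
      using S(2) S'(2) unfolding supports_def by simp
    moreover have "card (S \<union> S') \<le> m + m'"
      using card_Un_le[of S S'] S(1) S'(1) by simp
    ultimately show ?thesis by blast
  qed
  then show ?thesis unfolding witnessed_def by blast
qed

text \<open>The chosen value joins the witness set and nothing is embedded afresh, so any number of
  variables may remain free.\<close>

lemma witnessed_Exists:
  assumes "witnessed ps \<phi>"
  shows "witnessed ps (Exists x \<phi>)"
proof -
  obtain k m where km: "\<And>T v. T \<in> trees (set ps) \<Longrightarrow> v ` fv \<phi> \<subseteq> nodes T \<Longrightarrow> sat T v \<phi> \<Longrightarrow>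
    \<exists>S. card S \<le> m \<and> supports ps k \<phi> T v S"
    using assms unfolding witnessed_def by blast
  have "\<exists>S. card S \<le> Suc m \<and> supports ps k (Exists x \<phi>) T v S"
    if T: "T \<in> trees (set ps)" "v ` fv (Exists x \<phi>) \<subseteq> nodes T" "sat T v (Exists x \<phi>)" for T v
  proof -
    obtain b where b: "b \<in> nodes T" "sat T (v(x := b)) \<phi>" using T(3) by auto
    have "(v(x := b)) ` fv \<phi> \<subseteq> nodes T" using T(2) b(1) by auto
    from km[OF T(1) this b(2)] obtain S where S: "card S \<le> m" "supports ps k \<phi> T (v(x := b)) S" by blast
    have sub: "(v(x := b)) ` fv \<phi> \<union> S \<subseteq> v ` fv (Exists x \<phi>) \<union> insert b S" by auto
    have "sat T' (f \<circ> v) (Exists x \<phi>)"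
      if T': "T' \<in> trees (set ps)" "embeds ps k T T' (v ` fv (Exists x \<phi>) \<union> insert b S) f" for T' f
    proof -
      have "sat T' (f \<circ> v(x := b)) \<phi>" by (rule supportsD[OF S(2) T' order_refl sub])
      moreover have "f b \<in> nodes T'" using T'(2) unfolding embeds_def by blast
      ultimately show ?thesis unfolding fun_upd_comp sat.simps by (rule bexI)
    qed
    then have "supports ps k (Exists x \<phi>) T v (insert b S)"
      using S(2) b(1) unfolding supports_def by blast
    moreover have "card (insert b S) \<le> Suc m"
      using S unfolding supports_def by (simp add: card_insert_if)
    ultimately show ?thesis by blast
  qed
  then show ?thesis unfolding witnessed_def by blast
qed

text \<open>With at most one free variable, its value and the bounded witness set can be embedded
  together around the anchor; the resulting map agrees with \<open>f\<close> where it
  matters.\<close>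

lemma witnessed_invariant:
  assumes "witnessed ps \<phi>" "fv \<phi> \<subseteq> {w}"
  shows "invariant ps \<phi>"
proof (rule invariantI)
  fix V :: "nat set"
  assume V: "V \<noteq> {}" "fv \<phi> \<subseteq> V"
  obtain z where z: "z \<in> V" "fv \<phi> \<subseteq> {z}"
    using V assms(2) by blast
  obtain k m where km: "\<And>T v. T \<in> trees (set ps) \<Longrightarrow> v ` fv \<phi> \<subseteq> nodes T \<Longrightarrow> sat T v \<phi> \<Longrightarrow>
    \<exists>S. card S \<le> m \<and> supports ps k \<phi> T v S"
    using assms(1) unfolding witnessed_def by blast
  \<comment> \<open>There are at most \<open>m\<close> witnesses and one anchor.\<close>
  let ?n = "Suc m"
  have "sat T' (f \<circ> v) \<phi>"
    if T: "T \<in> trees (set ps)" "T' \<in> trees (set ps)" "v ` V \<subseteq> nodes T"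
      "embeds ps (k + 4 * (?n * ?n)) T T' (v ` V) f" and s: "sat T v \<phi>" for T T' v f
  proof -
    have "v ` fv \<phi> \<subseteq> nodes T" using T(3) V(2) by blast
    from km[OF T(1) this s] obtain S where S: "card S \<le> m" "supports ps k \<phi> T v S" by blast
    let ?S = "insert (v z) S"
    have fin: "finite ?S" and sub: "?S \<subseteq> nodes T" and crd: "card ?S \<le> ?n"
      using S T(3) z(1) unfolding supports_def by (auto simp: card_insert_if)
    have "f (v z) \<in> nodes T'" "type_eq ps (k + 4 * (?n * ?n)) T (v z) T' (f (v z))"
      using T(4) z(1) unfolding embeds_def by auto
    then obtain g where g: "embeds ps k T T' ?S g" "g (v z) = f (v z)"
      using embeds_extend[OF T(1) fin sub crd insertI1] by blast
    have "v ` fv \<phi> \<union> S \<subseteq> ?S" using z(2) by auto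
    then have "sat T' (g \<circ> v) \<phi>" by (rule supportsD[OF S(2) T(2) g(1) order_refl])
    moreover have "(g \<circ> v) y = (f \<circ> v) y" if "y \<in> fv \<phi>" for y using that z(2) g(2) by auto
    ultimately show ?thesis using sat_cong[of \<phi> "g \<circ> v" "f \<circ> v" T'] by blast
  qed
  then show "\<exists>k. \<forall>T\<in>trees (set ps). \<forall>T'\<in>trees (set ps). \<forall>v f. v ` V \<subseteq> nodes T \<longrightarrow>
    embeds ps k T T' (v ` V) f \<longrightarrow> sat T v \<phi> \<longrightarrow> sat T' (f \<circ> v) \<phi>"
    by blast
qed

text \<open>Being witnessed does not pass directly to negations. As a negated formula has at most
  one free variable, it is first turned into an invariant one, negated there, and turned
  back.\<close>

lemma witnessed_UNFO: "wff_UNFO \<phi> \<Longrightarrow> preds \<phi> \<subseteq> set ps \<Longrightarrow> witnessed ps \<phi>"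
proof (induction rule: wff_UNFO.induct)
  case (7 \<phi>)
  have "\<forall>x\<in>fv \<phi>. \<forall>y\<in>fv \<phi>. x = y"
    using 7(2) card_le_Suc0_iff_eq[OF finite_fv[of \<phi>]] by simp
  then obtain w where "fv \<phi> \<subseteq> {w}" by blast
  then have "invariant ps \<phi>" using witnessed_invariant 7 by auto
  then show ?case by (rule invariant_witnessed[OF invariant_Neg])
qed (auto intro: invariant_Unary invariant_Nav invariant_Eql witnessed_Disj witnessed_Conj
      witnessed_Exists invariant_witnessed)

section \<open>From CoreXPath to the other logics\<close>

lemma sat_std_trans: "x \<noteq> y \<Longrightarrow> sat T v (std_trans \<chi> x y) \<longleftrightarrow> xsat T (v x) \<chi>"
  by (induction \<chi> arbitrary: v x y) auto

lemma fv_std_trans: "x \<noteq> y \<Longrightarrow> fv (std_trans \<chi> x y) = {x}"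
  by (induction \<chi> arbitrary: x y) auto

lemma vars_std_trans: "vars (std_trans \<chi> x y) \<subseteq> {x, y}"
proof (induction \<chi> arbitrary: x y)
  case (XDia r \<chi>)
  then show ?case using XDia.IH[of y x] by auto
next
  case (XDia_inv r \<chi>)
  then show ?case using XDia_inv.IH[of y x] by auto
qed auto

lemma preds_std_trans: "preds (std_trans \<chi> x y) = props \<chi>"
  by (induction \<chi> arbitrary: x y) auto

lemma counting_free_std_trans: "counting_free (std_trans \<chi> x y)"
  by (induction \<chi> arbitrary: x y) auto

lemma wff_UNFO_std_trans: "x \<noteq> y \<Longrightarrow> wff_UNFO (std_trans \<chi> x y)"
  by (induction \<chi> arbitrary: x y) (auto intro!: wff_UNFO.intros simp: fv_std_trans)

text \<open>The navigational atom of each modality contains both variables and acts as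
  guard.\<close>

lemma wff_GF_std_trans: "x \<noteq> y \<Longrightarrow> wff_GF (std_trans \<chi> x y)"
proof (induction \<chi> arbitrary: x y)
  case (XDia r \<chi>)
  then show ?case
    using wff_GF.intros(8)[OF guard.intros(2), of "std_trans \<chi> y x" r x y "[y]"] by (auto simp: fv_std_trans)
next
  case (XDia_inv r \<chi>)
  then show ?case
    using wff_GF.intros(8)[OF guard.intros(2), of "std_trans \<chi> y x" r y x "[y]"] by (auto simp: fv_std_trans)
qed (auto intro: wff_GF.intros)

section \<open>A translation without conjunction for the one-dimensional fragment\<close>

abbreviation neg_disj :: "'p fm \<Rightarrow> 'p fm \<Rightarrow> 'p fm" where
  "neg_disj \<phi> \<psi> \<equiv> Neg (Disj (Neg \<phi>) (Neg \<psi>))"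

text \<open>The standard translation with \<open>neg_disj\<close> for conjunction, as
  \<open>wff_F1\<close> has no rule for \<open>Conj\<close>.\<close>

primrec f1_trans :: "'p xpath \<Rightarrow> nat \<Rightarrow> nat \<Rightarrow> 'p fm" where
  "f1_trans (XProp p) x y = Unary p x"
| "f1_trans XTop x y = Eql x x"
| "f1_trans (XNeg \<phi>) x y = Neg (f1_trans \<phi> x y)"
| "f1_trans (XConj \<phi> \<psi>) x y = neg_disj (f1_trans \<phi> x y) (f1_trans \<psi> x y)"
| "f1_trans (XDisj \<phi> \<psi>) x y = Disj (f1_trans \<phi> x y) (f1_trans \<psi> x y)"
| "f1_trans (XDia r \<phi>) x y = Exists y (neg_disj (Nav r x y) (f1_trans \<phi> y x))"
| "f1_trans (XDia_inv r \<phi>) x y = Exists y (neg_disj (Nav r y x) (f1_trans \<phi> y x))"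

lemma sat_f1_trans: "x \<noteq> y \<Longrightarrow> sat T v (f1_trans \<chi> x y) \<longleftrightarrow> xsat T (v x) \<chi>"
  by (induction \<chi> arbitrary: v x y) auto

lemma fv_f1_trans: "x \<noteq> y \<Longrightarrow> fv (f1_trans \<chi> x y) = {x}"
  by (induction \<chi> arbitrary: x y) auto

lemma preds_f1_trans: "preds (f1_trans \<chi> x y) = props \<chi>"
  by (induction \<chi> arbitrary: x y) auto

lemma wff_F1_f1_trans: "x \<noteq> y \<Longrightarrow> wff_F1 (f1_trans \<chi> x y)"
proof (induction \<chi> arbitrary: x y)
  case (XDia r \<chi>)
  then have "wff_F1 (neg_disj (Nav r x y) (f1_trans \<chi> y x))"
    by (auto intro!: wff_F1.intros(1-5))
  then show ?case
    \<comment> \<open>The rule is applied to the list \<open>x, y\<close>, of which only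
      \<open>y\<close> gets quantified.\<close>
    using wff_F1.intros(7)[of "neg_disj (Nav r x y) (f1_trans \<chi> y x)" x "[y]"] XDia.prems
    by (simp add: fv_f1_trans)
next
  case (XDia_inv r \<chi>)
  then have "wff_F1 (neg_disj (Nav r y x) (f1_trans \<chi> y x))"
    by (auto intro!: wff_F1.intros(1-5))
  then show ?case
    using wff_F1.intros(7)[of "neg_disj (Nav r y x) (f1_trans \<chi> y x)" x "[y]"] XDia_inv.prems
    by (simp add: fv_f1_trans)
qed (auto intro!: wff_F1.intros(1-5))

section \<open>Pairwise comparison of the six logics\<close>

theorem theorem5p1:
  fixes P :: "'p set"
  assumes "finite P"
  shows "\<forall>L1 \<in> {CoreXPath P, GF2 P, FO2 P, C2 P, UNFO P, F1 P}.
         \<forall>L2 \<in> {CoreXPath P, GF2 P, FO2 P, C2 P, UNFO P, F1 P}.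
           expr_equiv (trees P) L1 L2"
proof -
  let ?Ls = "{CoreXPath P, GF2 P, FO2 P, C2 P, UNFO P, F1 P}"
  obtain ps where ps: "set ps = P" using assms finite_list by blast
  have up: "definable ps \<phi>" if L: "L \<in> ?Ls" and \<phi>: "\<phi> \<in> L" "fv \<phi> = {x}" for L \<phi> x
  proof -
    \<comment> \<open>Three cases cover all six logics: \<open>CoreXPath P\<close> lies in
      \<open>UNFO P\<close>, while \<open>GF2 P\<close> and \<open>FO2 P\<close> lie in
      \<open>C2 P\<close>.\<close>
    have "CoreXPath P \<subseteq> UNFO P"
      unfolding CoreXPath_def UNFO_def by (auto simp: wff_UNFO_std_trans preds_std_trans)
    then consider "\<phi> \<in> C2 P" | "\<phi> \<in> UNFO P" | "\<phi> \<in> F1 P"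
      using L \<phi>(1) unfolding GF2_def FO2_def C2_def by blast
    then have "invariant ps \<phi>"
    proof cases
      case 1
      then show ?thesis using invariant_C2 ps unfolding C2_def by blast
    next
      case 2
      then have "witnessed ps \<phi>" using witnessed_UNFO ps unfolding UNFO_def by blast
      then show ?thesis using witnessed_invariant \<phi>(2) by blast
    next
      case 3
      then show ?thesis using invariant_F1 ps unfolding F1_def by blast
    qed
    then show ?thesis using invariant_definable \<phi>(2) by blast
  qed
  have down: "\<exists>\<psi>\<in>L. fv \<psi> = {x} \<and> (\<forall>T a. sat T (\<lambda>_. a) \<psi> \<longleftrightarrow> xsat T a \<chi>)"
    if L: "L \<in> ?Ls" and \<chi>: "props \<chi> \<subseteq> P" for L \<chi> x
  proof (cases "L = F1 P")
    case True
    have "f1_trans \<chi> x (Suc x) \<in> L"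
      using True \<chi> unfolding F1_def by (simp add: wff_F1_f1_trans preds_f1_trans)
    then show ?thesis
      by (intro bexI[of _ "f1_trans \<chi> x (Suc x)"]) (simp_all add: fv_f1_trans sat_f1_trans)
  next
    case False
    \<comment> \<open>One formula lies in all five remaining logics at once; \<open>Suc x\<close> is
      merely a second variable distinct from \<open>x\<close>.\<close>
    have "std_trans \<chi> x (Suc x) \<in> CoreXPath P"
      unfolding CoreXPath_def using \<chi> by (metis (mono_tags, lifting) mem_Collect_eq n_not_Suc_n)
    moreover have "std_trans \<chi> x (Suc x) \<in> C2 P" "std_trans \<chi> x (Suc x) \<in> FO2 P"
      "std_trans \<chi> x (Suc x) \<in> GF2 P" "std_trans \<chi> x (Suc x) \<in> UNFO P"
      unfolding C2_def FO2_def GF2_def UNFO_def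
      using \<chi> vars_std_trans[of \<chi> x "Suc x"]
      by (auto simp: wff_UNFO_std_trans wff_GF_std_trans preds_std_trans counting_free_std_trans)
    ultimately have "std_trans \<chi> x (Suc x) \<in> L" using L False by blast
    then show ?thesis
      by (intro bexI[of _ "std_trans \<chi> x (Suc x)"]) (simp_all add: fv_std_trans sat_std_trans)
  qed
  \<comment> \<open>Every comparison passes through a modal formula: \<open>up\<close> takes the
    given formula to it, \<open>down\<close> takes it into the target logic.\<close>
  have "expr_le (trees P) L1 L2" if "L1 \<in> ?Ls" "L2 \<in> ?Ls" for L1 L2
    unfolding expr_le_def
  proof (intro ballI allI impI)
    fix \<phi> x assume "\<phi> \<in> L1" "fv \<phi> = {x}"
    then have "definable ps \<phi>" using up that(1) by blast
    then obtain \<chi> where \<chi>: "props \<chi> \<subseteq> P"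
      "\<forall>T\<in>trees P. \<forall>a\<in>nodes T. sat T (\<lambda>_. a) \<phi> \<longleftrightarrow> xsat T a \<chi>"
      using ps unfolding definable_def by blast
    then show "\<exists>\<psi>\<in>L2. fv \<psi> = {x} \<and>
        (\<forall>T\<in>trees P. \<forall>a\<in>nodes T. sat T (\<lambda>_. a) \<phi> \<longleftrightarrow> sat T (\<lambda>_. a) \<psi>)"
      using down[OF that(2) \<chi>(1), of x] by metis
  qed
  then show ?thesis unfolding expr_equiv_def by blast
qed

end
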